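(* Let $u^0,v^0\in H^2_0(\Omega)$ and $f\in L^2(0,T;L^2(\Omega))$, and let $u_h:[0,T]\to V_h$ be the solution of the semidiscrete problem $$(u_{htt},v_h)+a_h(u_h,v_h)=(f,v_h)\ \text{ for all }v_h\in V_h,\qquad u_h(0)=\mathcal R_hu^0,\quad u_{ht}(0)=\mathcal R_hv^0 .$$ Then there is a constant $C>0$, depending on $\alpha$, $\beta$ and $T$ but independent of the mesh-size, such that for every $t\in(0,T]$ $$\|u_{ht}(t)\|+\|u_h(t)\|_h\le C\big(\|\mathcal R_hu^0\|_h+\|\mathcal R_hv^0\|+\|f\|_{L^2(0,T;L^2(\Omega))}\big).$$
   Context: $\Omega\subset\mathbb R^2$ is a bounded polygonal Lipschitz domain, $T>0$; $(\cdot,\cdot)$ and $\|\cdot\|$ are the $L^2(\Omega)$ inner product and norm; $a(w,v)=\int_\Omega D^2w:D^2v\,dx$ on $H^2_0(\Omega)$. Subscripts $t$ denote time derivatives. Mesh: $\mathcal T$ is a shape-regular triangulation of $\overline\Omega$ with mesh-size $h=\max_{K\in\mathcal T}\mathrm{diam}(K)$, edges $\mathcal E$, vertices $\mathcal V$; $\mathcal V(e)$ is the set of endpoints of edge $e$ and $h_e$ its length; $[\![\cdot]\!]$ is the jump across an interior edge and the trace on a boundary edge; $\{\!\{\cdot\}\!\}$ is the average across an interior edge; ⨍ denotes an integral mean; $H^2(\mathcal T)$ is the space of piecewise $H^2$ functions; $P_r(\mathcal T)$ is the space of piecewise polynomials of degree at most $r$. Discrete space and form: $\mathrm M(\mathcal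 T)\subset P_2(\mathcal T)$ is the Morley space: piecewise quadratics continuous at interior vertices, with normal derivatives continuous at midpoints of interior edges, vanishing at boundary vertices and with normal derivatives vanishing at midpoints of boundary edges. $V_h\subset H^2(\mathcal T)$ is a finite-dimensional subspace with the norm $$\|v_h\|_h^2=\sum_{K\in\mathcal T}|v_h|_{H^2(K)}^2+\sum_{e\in\mathcal E}\sum_{z\in\mathcal V(e)}h_e^{-2}\big|[\![v_h]\!](z)\big|^2+\sum_{e\in\mathcal E}\Big|\frac1{h_e}\int_e\Big[\!\Big[\frac{\partial v_h}{\partial n}\Big]\!\Big]ds\Big|^2 ,$$ and $a_h$ is a symmetric bilinear form on $V_h+\mathrm M(\mathcal T)$ such that, for all $w_h,v_h\in V_h$, $\alpha\|w_h\|_h^2\le a_h(w_h,w_h)$ and $a_h(w_h,v_h)\le\beta\|w_h\|_h\|v_h\|_h$ with constants $\alpha,\beta>0$. (The Morley, quadratic discontinuous Galerkin and quadratic $C^0$ interior penalty methods are instances.) Smoother: $I_{\mathrm M}:H^2(\mathcal T)\to\mathrm M(\mathcal T)$ is the extended Morley interpolation: at each interior vertex $z$, $(I_{\mathrm M}v)(z)$ is the average of the values $(v|_K)(z)$ over the triangles $K$ containing $z$, and on each interior edge $\int_e\partial_n(I_{\mathrm M}v)\,ds=\int_e\{\!\{\partial_nv\}\!\}\,ds$ (boundary degrees of freedom vanish since $I_{\mathrm M}v\in\mathrm M(\mathcal T)$). $J:\mathrm M(\mathcal T)\to H^2_0(\Omega)$ is a fixed linear companion operator, with values in the sum of the Hsieh–Clough–Tocher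 space and $P_8(\mathcal T)$, such that for $w\in\mathrm M(\mathcal T)$: $Jw=w$ at all vertices, $\nabla(Jw)(z)$ is the average of $(\nabla w|_K)(z)$ over the triangles $K$ containing $z$ at every interior vertex $z$, and $\int_e\partial_n(Jw)\,ds=\int_e\partial_nw\,ds$ for every edge $e$. Put $Q:=J I_{\mathrm M}:V_h\to H^2_0(\Omega)$. Modified Ritz projection $\mathcal R_h:H^2_0(\Omega)\to V_h$: $a_h(\mathcal R_hw,v_h)=a(w,Qv_h)$ for all $v_h\in V_h$. *)

theory Defs
  imports "HOL-Analysis.Analysis"
begin

section \<open>Lebesgue and Sobolev spaces in the plane\<close>

type_synonym plane = "real^2"
type_synonym sfun = "real^2 \<Rightarrow> real"

definition L2 :: "plane set \<Rightarrow> sfun set" where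
  "L2 U = {v. v \<in> borel_measurable (lebesgue_on U) \<and> integrable (lebesgue_on U) (\<lambda>x. (v x)\<^sup>2)}"

definition L2_inner :: "plane set \<Rightarrow> sfun \<Rightarrow> sfun \<Rightarrow> real" where
  "L2_inner U v w = (\<integral>x. v x * w x \<partial>lebesgue_on U)"

definition L2_norm :: "plane set \<Rightarrow> sfun \<Rightarrow> real" where
  "L2_norm U v = sqrt (\<integral>x. (v x)\<^sup>2 \<partial>lebesgue_on U)"

definition pderiv1 :: "2 \<Rightarrow> sfun \<Rightarrow> sfun" where
  "pderiv1 i \<phi> = (\<lambda>x. frechet_derivative \<phi> (at x) (axis i 1))"

definition pderivs :: "2 list \<Rightarrow> sfun \<Rightarrow> sfun" where
  "pderivs is \<phi> = foldr pderiv1 is \<phi>"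

definition grad :: "sfun \<Rightarrow> plane \<Rightarrow> plane" where
  "grad v x = (\<chi> i. pderiv1 i v x)"

definition smooth :: "sfun \<Rightarrow> bool" where
  "smooth \<phi> \<longleftrightarrow> (\<forall>is x. pderivs is \<phi> differentiable (at x))"

definition test_functions :: "plane set \<Rightarrow> sfun set" where
  "test_functions U =
     {\<phi>. smooth \<phi> \<and> compact (closure {x. \<phi> x \<noteq> 0}) \<and> closure {x. \<phi> x \<noteq> 0} \<subseteq> U}"

definition is_weak_deriv :: "plane set \<Rightarrow> 2 list \<Rightarrow> sfun \<Rightarrow> sfun \<Rightarrow> bool" where
  "is_weak_deriv U is v g \<longleftrightarrow>
     (\<forall>\<phi>\<in>test_functions U.
        L2_inner U v (pderivs is \<phi>) = (-1) ^ length is * L2_inner U g \<phi>)"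

definition weak_deriv :: "plane set \<Rightarrow> 2 list \<Rightarrow> sfun \<Rightarrow> sfun" where
  "weak_deriv U is v = (SOME g. g \<in> L2 U \<and> is_weak_deriv U is v g)"

definition sobolev_H :: "nat \<Rightarrow> plane set \<Rightarrow> sfun set" where
  "sobolev_H k U =
     {v \<in> L2 U. \<forall>is. length is \<le> k \<longrightarrow> (\<exists>g\<in>L2 U. is_weak_deriv U is v g)}"

text \<open>Convergence in the norm of \<open>sobolev_H k U\<close> of smooth functions to a Sobolev function.\<close>

definition H_approx :: "nat \<Rightarrow> plane set \<Rightarrow> (nat \<Rightarrow> sfun) \<Rightarrow> sfun \<Rightarrow> bool" where
  "H_approx k U \<phi> v \<longleftrightarrow>
     (\<forall>is. length is \<le> k \<longrightarrow>
        (\<lambda>n. L2_norm U (\<lambda>x. pderivs is (\<phi> n) x - weak_deriv U is v x)) \<longlonglongrightarrow> 0)"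

text \<open>
  The closure of the test functions in \<open>sobolev_H 2 \<Omega>\<close>. In two dimensions every element has exactly
  one representative that is continuous on the whole plane and vanishes off \<open>\<Omega>\<close>; classes modulo
  null sets are represented by it, so that point values make sense.
\<close>

definition H2_0 :: "plane set \<Rightarrow> sfun set" where
  "H2_0 \<Omega> =
     {v \<in> sobolev_H 2 \<Omega>. continuous_on UNIV v \<and> (\<forall>x. x \<notin> \<Omega> \<longrightarrow> v x = 0) \<and>
        (\<exists>\<phi>. (\<forall>n. \<phi> n \<in> test_functions \<Omega>) \<and> H_approx 2 \<Omega> \<phi> v)}"

definition form_a :: "plane set \<Rightarrow> sfun \<Rightarrow> sfun \<Rightarrow> real" where
  "form_a \<Omega> w v =
     (\<integral>x. (\<Sum>i\<in>UNIV. \<Sum>j\<in>UNIV. weak_deriv \<Omega> [i, j] w x * weak_deriv \<Omega> [i, j] v x)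
        \<partial>lebesgue_on \<Omega>)"

section \<open>Domain and triangulation\<close>

definition lipschitz_boundary :: "plane set \<Rightarrow> bool" where
  "lipschitz_boundary \<Omega> \<longleftrightarrow>
     (\<forall>p\<in>frontier \<Omega>. \<exists>\<tau> \<nu> r s L g.
        norm \<tau> = 1 \<and> norm \<nu> = 1 \<and> \<tau> \<bullet> \<nu> = 0 \<and> 0 < r \<and> 0 < s \<and>
        L-lipschitz_on {-r<..<r} (g :: real \<Rightarrow> real) \<and>
        (\<forall>\<xi> \<eta>. \<bar>\<xi>\<bar> < r \<longrightarrow> \<bar>\<eta>\<bar> < s \<longrightarrow>
           (p + \<xi> *\<^sub>R \<tau> + \<eta> *\<^sub>R \<nu> \<in> \<Omega> \<longleftrightarrow> g \<xi> < \<eta>)))"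

definition polygonal_lipschitz_domain :: "plane set \<Rightarrow> bool" where
  "polygonal_lipschitz_domain \<Omega> \<longleftrightarrow>
     open \<Omega> \<and> connected \<Omega> \<and> \<Omega> \<noteq> {} \<and> bounded \<Omega> \<and> lipschitz_boundary \<Omega> \<and>
     (\<exists>S. finite S \<and> frontier \<Omega> = (\<Union>(a, b)\<in>S. closed_segment a b))"

definition inradius :: "plane set \<Rightarrow> real" where
  "inradius K = Sup {r. \<exists>x. cball x r \<subseteq> K}"

definition shape_regular_triangulation :: "real \<Rightarrow> plane set \<Rightarrow> plane set set \<Rightarrow> bool" where
  "shape_regular_triangulation \<gamma> \<Omega> \<T> \<longleftrightarrow>
     triangulation \<T> \<and> (\<forall>K\<in>\<T>. 2 simplex K) \<and> \<Union>\<T> = closure \<Omega> \<and>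
     (\<forall>K\<in>\<T>. diameter K \<le> \<gamma> * inradius K)"

definition edges :: "plane set set \<Rightarrow> plane set set" where
  "edges \<T> = {e. \<exists>K\<in>\<T>. e edge_of K}"

definition vertices_of :: "plane set \<Rightarrow> plane set" where
  "vertices_of F = {z. z extreme_point_of F}"

definition vertices :: "plane set set \<Rightarrow> plane set" where
  "vertices \<T> = (\<Union>K\<in>\<T>. vertices_of K)"

definition interior_edges :: "plane set \<Rightarrow> plane set set \<Rightarrow> plane set set" where
  "interior_edges \<Omega> \<T> = {e \<in> edges \<T>. \<not> e \<subseteq> frontier \<Omega>}"

definition boundary_edges :: "plane set \<Rightarrow> plane set set \<Rightarrow> plane set set" where
  "boundary_edges \<Omega> \<T> = {e \<in> edges \<T>. e \<subseteq> frontier \<Omega>}"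

text \<open>The barycentre of a simplex, in particular the midpoint of an edge.\<close>

definition mid :: "plane set \<Rightarrow> plane" where
  "mid F = (1 / real (card (vertices_of F))) *\<^sub>R (\<Sum>z\<in>vertices_of F. z)"

definition patch :: "plane set set \<Rightarrow> plane \<Rightarrow> plane set set" where
  "patch \<T> z = {K \<in> \<T>. z \<in> K}"

text \<open>
  An interior edge is shared by \<open>tri_plus\<close> and \<open>tri_minus\<close>, numbered by an arbitrary fixed choice;
  a boundary edge only has \<open>tri_plus\<close>. The unit normal of an edge points out of \<open>tri_plus\<close>.
\<close>

definition tri_plus :: "plane set set \<Rightarrow> plane set \<Rightarrow> plane set" where
  "tri_plus \<T> e = (SOME K. K \<in> \<T> \<and> e edge_of K)"

definition tri_minus :: "plane set set \<Rightarrow> plane set \<Rightarrow> plane set" where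
  "tri_minus \<T> e = (SOME K. K \<in> \<T> \<and> e edge_of K \<and> K \<noteq> tri_plus \<T> e)"

definition edge_normal :: "plane set set \<Rightarrow> plane set \<Rightarrow> plane" where
  "edge_normal \<T> e =
     (SOME \<nu>. norm \<nu> = 1 \<and> (\<forall>x\<in>tri_plus \<T> e. \<forall>y\<in>e. (x - y) \<bullet> \<nu> \<le> 0))"

text \<open>Here \<open>q K\<close> is the one-sided value, seen from the triangle \<open>K\<close>, of a piecewise defined quantity.\<close>

definition jump :: "plane set \<Rightarrow> plane set set \<Rightarrow> plane set \<Rightarrow> (plane set \<Rightarrow> real) \<Rightarrow> real" where
  "jump \<Omega> \<T> e q =
     (if e \<in> interior_edges \<Omega> \<T> then q (tri_plus \<T> e) - q (tri_minus \<T> e)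
      else q (tri_plus \<T> e))"

definition average :: "plane set set \<Rightarrow> plane set \<Rightarrow> (plane set \<Rightarrow> real) \<Rightarrow> real" where
  "average \<T> e q = (q (tri_plus \<T> e) + q (tri_minus \<T> e)) / 2"

section \<open>Traces\<close>

definition edge_ends :: "plane set \<Rightarrow> plane \<times> plane" where
  "edge_ends e = (SOME (a, b). e = closed_segment a b)"

definition edge_point :: "plane set \<Rightarrow> real \<Rightarrow> plane" where
  "edge_point e s = (1 - s) *\<^sub>R fst (edge_ends e) + s *\<^sub>R snd (edge_ends e)"

definition edge_integral :: "plane set \<Rightarrow> sfun \<Rightarrow> real" where
  "edge_integral e g = diameter e * (\<integral>s. g (edge_point e s) \<partial>lebesgue_on {0..1})"

definition edge_L2 :: "plane set \<Rightarrow> sfun set" where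
  "edge_L2 e =
     {g. (\<lambda>s. g (edge_point e s)) \<in> borel_measurable (lebesgue_on {0..1}) \<and>
         integrable (lebesgue_on {0..1}) (\<lambda>s. (g (edge_point e s))\<^sup>2)}"

text \<open>
  The trace on the edge \<open>e\<close> of \<open>w\<close> in \<open>sobolev_H 1 (interior K)\<close>: the continuous extension, from
  smooth functions, of the restriction to \<open>e\<close>.
\<close>

definition is_edge_trace :: "plane set \<Rightarrow> plane set \<Rightarrow> sfun \<Rightarrow> sfun \<Rightarrow> bool" where
  "is_edge_trace K e w g \<longleftrightarrow> g \<in> edge_L2 e \<and>
     (\<exists>\<phi>. (\<forall>n. smooth (\<phi> n)) \<and> H_approx 1 (interior K) \<phi> w \<and>
          (\<lambda>n. edge_integral e (\<lambda>x. (\<phi> n x - g x)\<^sup>2)) \<longlonglongrightarrow> 0)"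

definition edge_trace :: "plane set \<Rightarrow> plane set \<Rightarrow> sfun \<Rightarrow> sfun" where
  "edge_trace K e w = (SOME g. is_edge_trace K e w g)"

text \<open>The normal derivative of \<open>v\<close> restricted to \<open>K\<close>, along the fixed normal of the edge \<open>e\<close>.\<close>

definition normal_trace :: "plane set set \<Rightarrow> plane set \<Rightarrow> plane set \<Rightarrow> sfun \<Rightarrow> sfun" where
  "normal_trace \<T> K e v x =
     (\<Sum>i\<in>UNIV. edge_normal \<T> e $ i * edge_trace K e (weak_deriv (interior K) [i] v) x)"

text \<open>Values at points of the closed triangle \<open>K\<close> of \<open>v\<close> and of its gradient, taken from inside \<open>K\<close>.\<close>

definition value_on :: "plane set \<Rightarrow> sfun \<Rightarrow> plane \<Rightarrow> real" where
  "value_on K v z = Lim (at z within interior K) v"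

definition grad_on :: "plane set \<Rightarrow> sfun \<Rightarrow> plane \<Rightarrow> plane" where
  "grad_on K v z = Lim (at z within interior K) (grad v)"

section \<open>Piecewise function spaces\<close>

text \<open>
  Piecewise functions are represented by functions on the plane that are set to zero outside the
  open triangles. On each open triangle the unique continuous representative is used.
\<close>

definition vanishes_off_triangles :: "plane set set \<Rightarrow> sfun \<Rightarrow> bool" where
  "vanishes_off_triangles \<T> v \<longleftrightarrow> (\<forall>x. x \<notin> (\<Union>K\<in>\<T>. interior K) \<longrightarrow> v x = 0)"

definition H2_piecewise :: "plane set set \<Rightarrow> sfun set" where
  "H2_piecewise \<T> =
     {v. vanishes_off_triangles \<T> v \<and>
         (\<forall>K\<in>\<T>. v \<in> sobolev_H 2 (interior K) \<and> continuous_on (interior K) v)}"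

definition polynomials :: "nat \<Rightarrow> sfun set" where
  "polynomials r =
     {p. \<exists>c :: nat \<Rightarrow> nat \<Rightarrow> real. \<forall>x. p x = (\<Sum>i\<le>r. \<Sum>j\<le>r - i. c i j * (x $ 1) ^ i * (x $ 2) ^ j)}"

definition P_piecewise :: "nat \<Rightarrow> plane set set \<Rightarrow> sfun set" where
  "P_piecewise r \<T> =
     {v. vanishes_off_triangles \<T> v \<and>
         (\<forall>K\<in>\<T>. \<exists>p\<in>polynomials r. \<forall>x\<in>interior K. v x = p x)}"

definition morley :: "plane set \<Rightarrow> plane set set \<Rightarrow> sfun set" where
  "morley \<Omega> \<T> =
     {v \<in> P_piecewise 2 \<T>.
        (\<forall>z\<in>vertices \<T> \<inter> \<Omega>. \<forall>K\<in>patch \<T> z. \<forall>K'\<in>patch \<T> z. value_on K v z = value_on K' v z) \<and>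
        (\<forall>z\<in>vertices \<T> \<inter> frontier \<Omega>. \<forall>K\<in>patch \<T> z. value_on K v z = 0) \<and>
        (\<forall>e\<in>interior_edges \<Omega> \<T>. \<forall>K\<in>\<T>. \<forall>K'\<in>\<T>. e edge_of K \<longrightarrow> e edge_of K' \<longrightarrow>
           grad_on K v (mid e) \<bullet> edge_normal \<T> e = grad_on K' v (mid e) \<bullet> edge_normal \<T> e) \<and>
        (\<forall>e\<in>boundary_edges \<Omega> \<T>. \<forall>K\<in>\<T>. e edge_of K \<longrightarrow>
           grad_on K v (mid e) \<bullet> edge_normal \<T> e = 0)}"

text \<open>Each triangle is split into three by joining its vertices to its barycentre.\<close>

definition HCT :: "plane set \<Rightarrow> plane set set \<Rightarrow> sfun set" where
  "HCT \<Omega> \<T> =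
     {v \<in> H2_0 \<Omega>. \<forall>K\<in>\<T>. \<forall>e. e edge_of K \<longrightarrow>
        (\<exists>p\<in>polynomials 3. \<forall>x\<in>convex hull (insert (mid K) e). v x = p x)}"

definition fun_subspace :: "sfun set \<Rightarrow> bool" where
  "fun_subspace V \<longleftrightarrow>
     (\<lambda>x. 0) \<in> V \<and> (\<forall>v\<in>V. \<forall>w\<in>V. (\<lambda>x. v x + w x) \<in> V) \<and> (\<forall>c. \<forall>v\<in>V. (\<lambda>x. c * v x) \<in> V)"

definition fun_finite_dim :: "sfun set \<Rightarrow> bool" where
  "fun_finite_dim V \<longleftrightarrow>
     (\<exists>B. finite B \<and> B \<subseteq> V \<and> (\<forall>v\<in>V. \<exists>c. v = (\<lambda>x. \<Sum>b\<in>B. c b * b x)))"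

definition fun_set_sum :: "sfun set \<Rightarrow> sfun set \<Rightarrow> sfun set" where
  "fun_set_sum V W = {(\<lambda>x. v x + w x) | v w. v \<in> V \<and> w \<in> W}"

section \<open>The discretisation\<close>

definition discrete_space :: "plane set set \<Rightarrow> sfun set \<Rightarrow> bool" where
  "discrete_space \<T> V \<longleftrightarrow> V \<subseteq> H2_piecewise \<T> \<and> fun_subspace V \<and> fun_finite_dim V"

definition H2_seminorm_sq :: "plane set \<Rightarrow> sfun \<Rightarrow> real" where
  "H2_seminorm_sq K v =
     (\<Sum>i\<in>UNIV. \<Sum>j\<in>UNIV. (L2_norm (interior K) (weak_deriv (interior K) [i, j] v))\<^sup>2)"

definition norm_h :: "plane set \<Rightarrow> plane set set \<Rightarrow> sfun \<Rightarrow> real" where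
  "norm_h \<Omega> \<T> v = sqrt (
     (\<Sum>K\<in>\<T>. H2_seminorm_sq K v) +
     (\<Sum>e\<in>edges \<T>. \<Sum>z\<in>vertices_of e.
        \<bar>jump \<Omega> \<T> e (\<lambda>K. value_on K v z)\<bar>\<^sup>2 / (diameter e)\<^sup>2) +
     (\<Sum>e\<in>edges \<T>.
        \<bar>1 / diameter e * edge_integral e (\<lambda>x. jump \<Omega> \<T> e (\<lambda>K. normal_trace \<T> K e v x))\<bar>\<^sup>2))"

definition symmetric_bilinear_on :: "sfun set \<Rightarrow> (sfun \<Rightarrow> sfun \<Rightarrow> real) \<Rightarrow> bool" where
  "symmetric_bilinear_on S b \<longleftrightarrow>
     (\<forall>v\<in>S. \<forall>w\<in>S. b v w = b w v) \<and>
     (\<forall>u\<in>S. \<forall>v\<in>S. \<forall>w\<in>S. b (\<lambda>x. u x + v x) w = b u w + b v w) \<and>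
     (\<forall>c. \<forall>v\<in>S. \<forall>w\<in>S. b (\<lambda>x. c * v x) w = c * b v w)"

definition discrete_form ::
  "real \<Rightarrow> real \<Rightarrow> plane set \<Rightarrow> plane set set \<Rightarrow> sfun set \<Rightarrow> (sfun \<Rightarrow> sfun \<Rightarrow> real) \<Rightarrow> bool" where
  "discrete_form \<alpha> \<beta> \<Omega> \<T> V a\<^sub>h \<longleftrightarrow>
     symmetric_bilinear_on (fun_set_sum V (morley \<Omega> \<T>)) a\<^sub>h \<and>
     (\<forall>w\<in>V. \<alpha> * (norm_h \<Omega> \<T> w)\<^sup>2 \<le> a\<^sub>h w w) \<and>
     (\<forall>w\<in>V. \<forall>v\<in>V. a\<^sub>h w v \<le> \<beta> * norm_h \<Omega> \<T> w * norm_h \<Omega> \<T> v)"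

definition morley_interpolation :: "plane set \<Rightarrow> plane set set \<Rightarrow> sfun \<Rightarrow> sfun" where
  "morley_interpolation \<Omega> \<T> v =
     (THE m. m \<in> morley \<Omega> \<T> \<and>
        (\<forall>z\<in>vertices \<T> \<inter> \<Omega>. \<forall>K\<in>patch \<T> z.
           value_on K m z = (\<Sum>K'\<in>patch \<T> z. value_on K' v z) / real (card (patch \<T> z))) \<and>
        (\<forall>e\<in>interior_edges \<Omega> \<T>. \<forall>K\<in>\<T>. e edge_of K \<longrightarrow>
           edge_integral e (normal_trace \<T> K e m) =
           edge_integral e (\<lambda>x. average \<T> e (\<lambda>K'. normal_trace \<T> K' e v x))))"

definition companion_operator :: "plane set \<Rightarrow> plane set set \<Rightarrow> (sfun \<Rightarrow> sfun) \<Rightarrow> bool" where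
  "companion_operator \<Omega> \<T> J \<longleftrightarrow>
     (\<forall>w\<in>morley \<Omega> \<T>. \<forall>w'\<in>morley \<Omega> \<T>. J (\<lambda>x. w x + w' x) = (\<lambda>x. J w x + J w' x)) \<and>
     (\<forall>c. \<forall>w\<in>morley \<Omega> \<T>. J (\<lambda>x. c * w x) = (\<lambda>x. c * J w x)) \<and>
     (\<forall>w\<in>morley \<Omega> \<T>.
        J w \<in> H2_0 \<Omega> \<and>
        (\<exists>p\<in>HCT \<Omega> \<T>. \<exists>q\<in>P_piecewise 8 \<T>. \<forall>K\<in>\<T>. \<forall>x\<in>interior K. J w x = p x + q x) \<and>
        (\<forall>z\<in>vertices \<T>. \<forall>K\<in>patch \<T> z. J w z = value_on K w z) \<and>
        (\<forall>z\<in>vertices \<T> \<inter> \<Omega>.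
           GDERIV (J w) z :> (1 / real (card (patch \<T> z))) *\<^sub>R (\<Sum>K\<in>patch \<T> z. grad_on K w z)) \<and>
        (\<forall>e\<in>edges \<T>. \<forall>K\<in>\<T>. e edge_of K \<longrightarrow>
           edge_integral e (normal_trace \<T> K e (J w)) = edge_integral e (normal_trace \<T> K e w)))"

definition smoother :: "plane set \<Rightarrow> plane set set \<Rightarrow> (sfun \<Rightarrow> sfun) \<Rightarrow> sfun \<Rightarrow> sfun" where
  "smoother \<Omega> \<T> J v = J (morley_interpolation \<Omega> \<T> v)"

definition ritz ::
  "plane set \<Rightarrow> plane set set \<Rightarrow> sfun set \<Rightarrow> (sfun \<Rightarrow> sfun \<Rightarrow> real) \<Rightarrow> (sfun \<Rightarrow> sfun) \<Rightarrow> sfun \<Rightarrow> sfun"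
  where
  "ritz \<Omega> \<T> V a\<^sub>h J w =
     (THE r. r \<in> V \<and> (\<forall>v\<in>V. a\<^sub>h r v = form_a \<Omega> w (smoother \<Omega> \<T> J v)))"

section \<open>Time-dependent functions and the semidiscrete problem\<close>

text \<open>The Bochner space \<open>L\<^sup>2(0,T;L\<^sup>2(\<Omega>))\<close>: strongly measurable, square-integrable in norm.\<close>

definition L2_L2 :: "real \<Rightarrow> plane set \<Rightarrow> (real \<Rightarrow> sfun) set" where
  "L2_L2 T \<Omega> =
     {f. (\<exists>s. (\<forall>n. simple_function (lebesgue_on {0..T}) (s n) \<and> (\<forall>t\<in>{0..T}. s n t \<in> L2 \<Omega>)) \<and>
              (AE t in lebesgue_on {0..T}. f t \<in> L2 \<Omega> \<and>
                 (\<lambda>n. L2_norm \<Omega> (\<lambda>x. s n t x - f t x)) \<longlonglongrightarrow> 0)) \<and>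
         integrable (lebesgue_on {0..T}) (\<lambda>t. (L2_norm \<Omega> (f t))\<^sup>2)}"

definition L2_L2_norm :: "real \<Rightarrow> plane set \<Rightarrow> (real \<Rightarrow> sfun) \<Rightarrow> real" where
  "L2_L2_norm T \<Omega> f = sqrt (\<integral>t. (L2_norm \<Omega> (f t))\<^sup>2 \<partial>lebesgue_on {0..T})"

definition has_time_derivative ::
  "real \<Rightarrow> plane set \<Rightarrow> (real \<Rightarrow> sfun) \<Rightarrow> sfun \<Rightarrow> real \<Rightarrow> bool" where
  "has_time_derivative T \<Omega> u d t \<longleftrightarrow>
     ((\<lambda>s. L2_norm \<Omega> (\<lambda>x. (u s x - u t x) / (s - t) - d x)) \<longlongrightarrow> 0) (at t within {0..T})"

text \<open>
  Since \<open>f\<close> is only square-integrable in time, solutions are sought in \<open>H\<^sup>2(0,T;V)\<close>: \<open>u\<close> is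
  differentiable on \<open>[0,T]\<close> with derivative \<open>ut\<close>, and \<open>ut\<close> is absolutely continuous, that is, it
  has the derivative \<open>utt\<close> almost everywhere and is the Bochner integral of \<open>utt\<close> (written here by
  testing with the elements of \<open>L\<^sup>2(\<Omega>)\<close>). The equation holds at almost every time.
\<close>

definition semidiscrete_solution ::
  "real \<Rightarrow> plane set \<Rightarrow> sfun set \<Rightarrow> (sfun \<Rightarrow> sfun \<Rightarrow> real) \<Rightarrow> (real \<Rightarrow> sfun) \<Rightarrow> sfun \<Rightarrow> sfun \<Rightarrow>
     (real \<Rightarrow> sfun) \<Rightarrow> (real \<Rightarrow> sfun) \<Rightarrow> (real \<Rightarrow> sfun) \<Rightarrow> bool" where
  "semidiscrete_solution T \<Omega> V a\<^sub>h f w\<^sub>0 w\<^sub>1 u ut utt \<longleftrightarrow>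
     (\<forall>t\<in>{0..T}. u t \<in> V \<and> ut t \<in> V \<and> has_time_derivative T \<Omega> u (ut t) t) \<and>
     utt \<in> L2_L2 T \<Omega> \<and>
     (AE t in lebesgue_on {0..T}. utt t \<in> V \<and> has_time_derivative T \<Omega> ut (utt t) t) \<and>
     (\<forall>\<phi>\<in>L2 \<Omega>. \<forall>t\<in>{0..T}.
        L2_inner \<Omega> (ut t) \<phi> =
        L2_inner \<Omega> (ut 0) \<phi> + (\<integral>s. L2_inner \<Omega> (utt s) \<phi> \<partial>lebesgue_on {0..t})) \<and>
     (AE t in lebesgue_on {0..T}. \<forall>v\<in>V.
        L2_inner \<Omega> (utt t) v + a\<^sub>h (u t) v = L2_inner \<Omega> (f t) v) \<and>
     u 0 = w\<^sub>0 \<and> ut 0 = w\<^sub>1"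

end

theory Submission
  imports Defs
begin

text \<open>
  Testing the equation with the velocity shows that the energy
  \<open>\<parallel>u\<^sub>t\<parallel>\<^sup>2 + a\<^sub>h(u, u)\<close> grows by \<open>2 \<integral> (f, u\<^sub>t)\<close>. As \<open>u\<^sub>t\<close> is only absolutely continuous, this is
  done in coordinates with respect to an \<open>L\<^sup>2\<close>-orthonormal basis of \<open>V\<close>; the \<open>L\<^sup>2\<close> norm is definite
  on \<open>V\<close> because piecewise continuous functions that vanish almost everywhere on \<open>\<Omega>\<close> vanish on every
  open triangle. The energy is bounded below by coercivity and initially bounded above by continuity
  of \<open>a\<^sub>h\<close>, and the right-hand side is at most \<open>2 sqrt T \<parallel>f\<parallel> max \<parallel>u\<^sub>t\<parallel>\<close>.
\<close>

section \<open>The chain rule for absolutely continuous functions and the energy identity in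
  coordinates\<close>

text \<open>On an interval where \<open>d\<close> oscillates by at most \<open>e\<close>, replacing \<open>2 d\<close> in the integrand by the
  sum of its endpoint values costs at most \<open>2 e \<integral> \<bar>g\<bar>\<close>; sum over a fine partition.\<close>

lemma absolutely_continuous_square_has_integral:
  fixes g d :: "real \<Rightarrow> real"
  assumes "a \<le> b"
    and g: "g absolutely_integrable_on {a..b}"
    and d: "\<And>t. t \<in> {a..b} \<Longrightarrow> d t = d a + integral {a..t} g"
  shows "((\<lambda>s. 2 * d s * g s) has_integral (d b)\<^sup>2 - (d a)\<^sup>2) {a..b}"
proof -
  have gi: "g integrable_on {a..b}" and ga: "(\<lambda>s. \<bar>g s\<bar>) integrable_on {a..b}"
    using g by (auto simp: absolutely_integrable_on_def)
  have cd: "continuous_on {a..b} d"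
    by (rule continuous_on_eq[of _ "\<lambda>t. d a + integral {a..t} g"])
      (auto intro!: continuous_intros indefinite_integral_continuous_1 gi simp: d[symmetric])
  have dgi: "(\<lambda>s. 2 * d s * g s) integrable_on {a..b}"
  proof -
    have "(\<lambda>s. (2 * d s) * g s) absolutely_integrable_on {a..b}"
    proof (rule absolutely_integrable_bounded_measurable_product_real)
      show "(\<lambda>s. 2 * d s) \<in> borel_measurable (lebesgue_on {a..b})"
        by (intro continuous_imp_measurable_on_sets_lebesgue continuous_intros cd) auto
      show "bounded ((\<lambda>s. 2 * d s) ` {a..b})"
        by (intro compact_imp_bounded compact_continuous_image continuous_intros cd) auto
    qed (auto simp: g)
    then show ?thesis by (simp add: absolutely_integrable_on_def)
  qed
  \<comment> \<open>\<open>\<Phi>\<close> is the defect of the identity: the goal amounts to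
    \<open>\<Phi> b = \<Phi> a\<close>. Its increments will be dominated by those of the monotone
    function \<open>G\<close>, and the latter telescope over any partition.\<close>
  define \<Phi> where "\<Phi> t = (d t)\<^sup>2 - integral {a..t} (\<lambda>s. 2 * d s * g s)" for t
  define G where "G t = integral {a..t} (\<lambda>s. \<bar>g s\<bar>)" for t
  have split: "integral {a..t} h - integral {a..s} h = integral {s..t} h"
    if "h integrable_on {a..b}" "a \<le> s" "s \<le> t" "t \<le> b" for h :: "real \<Rightarrow> real" and s t
    using Henstock_Kurzweil_Integration.integral_combine[OF that(2,3), of h]
      integrable_subinterval_real[OF that(1), of a t] that
    by auto
  have step: "\<bar>\<Phi> t - \<Phi> s\<bar> \<le> 2 * e * (G t - G s)"
    if st: "a \<le> s" "s \<le> t" "t \<le> b"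
      and osc: "\<And>r r'. r \<in> {s..t} \<Longrightarrow> r' \<in> {s..t} \<Longrightarrow> \<bar>d r - d r'\<bar> \<le> e" for s t e
  proof -
    have sub: "h integrable_on {s..t}" if "h integrable_on {a..b}" for h :: "real \<Rightarrow> real"
      using integrable_subinterval_real[OF that, of s t] st by auto
    have "d t - d s = integral {s..t} g"
      using d[of t] d[of s] split[OF gi st] st by auto
    then have "(d t)\<^sup>2 - (d s)\<^sup>2 = integral {s..t} (\<lambda>r. (d t + d s) * g r)"
      by (simp add: power2_eq_square square_diff_square_factored)
    then have "\<Phi> t - \<Phi> s = integral {s..t} (\<lambda>r. (d t + d s) * g r) - integral {s..t} (\<lambda>r. 2 * d r * g r)"
      using split[OF dgi st] by (simp add: \<Phi>_def)
    also have "\<dots> = integral {s..t} (\<lambda>r. (d t + d s) * g r - 2 * d r * g r)"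
      by (intro integral_diff[symmetric] integrable_on_mult_right sub gi dgi)
    finally have eq: "\<Phi> t - \<Phi> s = integral {s..t} (\<lambda>r. (d t + d s) * g r - 2 * d r * g r)" .
    have "norm (integral {s..t} (\<lambda>r. (d t + d s) * g r - 2 * d r * g r)) \<le> integral {s..t} (\<lambda>r. 2 * e * \<bar>g r\<bar>)"
    proof (rule integral_norm_bound_integral)
      show "(\<lambda>r. (d t + d s) * g r - 2 * d r * g r) integrable_on {s..t}"
        by (intro integrable_diff integrable_on_mult_right sub gi dgi)
      show "(\<lambda>r. 2 * e * \<bar>g r\<bar>) integrable_on {s..t}"
        by (intro integrable_on_mult_right sub ga)
      fix r assume r: "r \<in> {s..t}"
      have "\<bar>d t + d s - 2 * d r\<bar> \<le> 2 * e"
        using osc[of t r] osc[of s r] r st by auto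
      then have "\<bar>d t + d s - 2 * d r\<bar> * \<bar>g r\<bar> \<le> 2 * e * \<bar>g r\<bar>"
        by (intro mult_right_mono) auto
      then show "norm ((d t + d s) * g r - 2 * d r * g r) \<le> 2 * e * \<bar>g r\<bar>"
        by (simp add: abs_mult[symmetric] algebra_simps)
    qed
    then show ?thesis
      using eq split[OF ga st] by (simp add: G_def)
  qed
  have small: "\<bar>\<Phi> b - \<Phi> a\<bar> \<le> 2 * e * G b" if "e > 0" for e
  proof -
    have "uniformly_continuous_on {a..b} d"
      by (intro compact_uniformly_continuous cd) auto
    then obtain \<delta> where "\<delta> > 0"
      and \<delta>: "\<And>x y. x \<in> {a..b} \<Longrightarrow> y \<in> {a..b} \<Longrightarrow> dist x y < \<delta> \<Longrightarrow> dist (d x) (d y) < e"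
      using \<open>e > 0\<close> unfolding uniformly_continuous_on_def by metis
    obtain N :: nat where N: "(b - a) / \<delta> < real N" using reals_Archimedean2 by blast
    have Npos: "N > 0" using N \<open>a \<le> b\<close> \<open>\<delta> > 0\<close>
      by (metis diff_ge_0_iff_ge divide_nonneg_pos gr0I not_less of_nat_0)
    define h where "h = (b - a) / N"
    have h: "0 \<le> h" "h < \<delta>" "h * N = b - a"
      using N Npos \<open>\<delta> > 0\<close> \<open>a \<le> b\<close> by (auto simp: h_def field_simps)
    define x where "x k = a + h * real k" for k
    have x0: "x 0 = a" and xN: "x N = b" using h by (auto simp: x_def)
    have xle: "x k \<le> b" if "k \<le> N" for k
      using that h mult_left_mono[of "real k" "real N" h] by (auto simp: x_def)
    have xge: "a \<le> x k" for k using h by (auto simp: x_def)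
    have xs: "x (Suc k) = x k + h" for k by (simp add: x_def algebra_simps)
    have "\<bar>\<Phi> (x (Suc k)) - \<Phi> (x k)\<bar> \<le> 2 * e * (G (x (Suc k)) - G (x k))" if "k < N" for k
    proof (rule step)
      fix r r' assume "r \<in> {x k..x (Suc k)}" "r' \<in> {x k..x (Suc k)}"
      moreover from this have "\<bar>r - r'\<bar> < \<delta>"
        using xs[of k] h by (auto simp: abs_if)
      ultimately show "\<bar>d r - d r'\<bar> \<le> e"
        using \<delta>[of r r'] xge[of k] xle[of "Suc k"] that by (auto simp: dist_real_def)
    qed (use xge xle[of "Suc k"] that xs h in auto)
    then have le: "(\<Sum>k<N. \<bar>\<Phi> (x (Suc k)) - \<Phi> (x k)\<bar>) \<le> (\<Sum>k<N. 2 * e * (G (x (Suc k)) - G (x k)))"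
      by (intro sum_mono) auto
    have "(\<Sum>k<N. 2 * e * (G (x (Suc k)) - G (x k))) = 2 * e * (G b - G a)"
      using sum_lessThan_telescope[of "\<lambda>k. G (x k)" N] by (simp add: sum_distrib_left[symmetric] x0 xN)
    moreover have "G a = 0" by (simp add: G_def)
    ultimately have "\<bar>\<Sum>k<N. \<Phi> (x (Suc k)) - \<Phi> (x k)\<bar> \<le> 2 * e * G b"
      using le order_trans[OF sum_abs[of "\<lambda>k. \<Phi> (x (Suc k)) - \<Phi> (x k)" "{..<N}"]] by simp
    then show ?thesis
      using sum_lessThan_telescope[of "\<lambda>k. \<Phi> (x k)" N] by (simp add: x0 xN)
  qed
  have "\<bar>\<Phi> b - \<Phi> a\<bar> \<le> 0"
  proof (rule field_le_epsilon)
    fix \<epsilon> :: real assume "\<epsilon> > 0"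
    have "G b \<ge> 0" unfolding G_def by (intro integral_nonneg ga) auto
    \<comment> \<open>The value of \<open>e\<close> is chosen to make the bound at most
      \<open>\<epsilon>\<close>; the \<open>+ 1\<close> in the denominator covers the case
      \<open>G b = 0\<close>.\<close>
    have "\<bar>\<Phi> b - \<Phi> a\<bar> \<le> 2 * (\<epsilon> / (2 * (G b + 1))) * G b"
      using \<open>\<epsilon> > 0\<close> \<open>G b \<ge> 0\<close> by (intro small) auto
    also have "\<dots> \<le> \<epsilon>"
      using \<open>\<epsilon> > 0\<close> \<open>G b \<ge> 0\<close> by (auto simp: field_simps)
    finally show "\<bar>\<Phi> b - \<Phi> a\<bar> \<le> 0 + \<epsilon>" by simp
  qed
  then have "integral {a..b} (\<lambda>s. 2 * d s * g s) = (d b)\<^sup>2 - (d a)\<^sup>2"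
    by (simp add: \<Phi>_def)
  with dgi show ?thesis
    using has_integral_integral by metis
qed

lemma quadratic_form_has_real_derivative:
  fixes A :: "'i \<Rightarrow> 'i \<Rightarrow> real" and c :: "'i \<Rightarrow> real \<Rightarrow> real"
  assumes "\<And>i j. i \<in> I \<Longrightarrow> j \<in> I \<Longrightarrow> A i j = A j i"
    and "\<And>i. i \<in> I \<Longrightarrow> (c i has_real_derivative d i) (at t within S)"
  shows "((\<lambda>t. \<Sum>i\<in>I. \<Sum>j\<in>I. A i j * c i t * c j t) has_real_derivative
           2 * (\<Sum>j\<in>I. d j * (\<Sum>i\<in>I. A i j * c i t))) (at t within S)"
proof -
  have "((\<lambda>t. \<Sum>i\<in>I. \<Sum>j\<in>I. A i j * (c i t * c j t)) has_real_derivative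
           (\<Sum>i\<in>I. \<Sum>j\<in>I. A i j * (d i * c j t + d j * c i t))) (at t within S)"
    by (intro DERIV_sum DERIV_cmult DERIV_mult assms(2))
  also have "(\<Sum>i\<in>I. \<Sum>j\<in>I. A i j * (d i * c j t + d j * c i t)) =
      (\<Sum>i\<in>I. \<Sum>j\<in>I. A i j * d i * c j t) + (\<Sum>i\<in>I. \<Sum>j\<in>I. A i j * d j * c i t)"
    by (simp add: algebra_simps sum.distrib)
  \<comment> \<open>The product rule gives two double sums; symmetry of \<open>A\<close> on
    \<open>I\<close> and renaming the indices make them equal, hence the factor 2.\<close>
  also have "(\<Sum>i\<in>I. \<Sum>j\<in>I. A i j * d i * c j t) = (\<Sum>i\<in>I. \<Sum>j\<in>I. A j i * d i * c j t)"
    by (intro sum.cong refl) (simp add: assms(1))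
  also have "\<dots> = (\<Sum>j\<in>I. d j * (\<Sum>i\<in>I. A i j * c i t))"
    by (simp add: sum_distrib_left mult_ac)
  also have "(\<Sum>i\<in>I. \<Sum>j\<in>I. A i j * d j * c i t) = (\<Sum>j\<in>I. d j * (\<Sum>i\<in>I. A i j * c i t))"
    by (subst sum.swap) (simp add: sum_distrib_left mult_ac)
  finally show ?thesis by (simp add: mult.assoc)
qed

text \<open>Here \<open>c\<close>, \<open>d\<close>, \<open>g\<close> stand for the coordinates of
  displacement, velocity and acceleration, \<open>A\<close> for the stiffness matrix and
  \<open>F\<close> for the load. The displacement is differentiable at every time, so the quadratic
  form in \<open>c\<close> is handled by the fundamental theorem of calculus; the velocity is only
  an indefinite integral, so its squares need the previous chain rule. Adding the two integrands
  gives the velocity times the left-hand side of the equation, which may be replaced by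
  \<open>F\<close> off the negligible set \<open>N\<close>.\<close>

lemma energy_identity:
  fixes I :: "'i set" and A :: "'i \<Rightarrow> 'i \<Rightarrow> real" and c d g F :: "'i \<Rightarrow> real \<Rightarrow> real"
  defines "energy \<equiv> \<lambda>t. (\<Sum>i\<in>I. (d i t)\<^sup>2) + (\<Sum>i\<in>I. \<Sum>j\<in>I. A i j * c i t * c j t)"
  assumes "finite I" and t: "t \<in> {0..T}"
    and sym: "\<And>i j. i \<in> I \<Longrightarrow> j \<in> I \<Longrightarrow> A i j = A j i"
    and c: "\<And>i s. i \<in> I \<Longrightarrow> s \<in> {0..T} \<Longrightarrow> (c i has_real_derivative d i s) (at s within {0..T})"
    and g: "\<And>i. i \<in> I \<Longrightarrow> g i absolutely_integrable_on {0..T}"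
    and d: "\<And>i s. i \<in> I \<Longrightarrow> s \<in> {0..T} \<Longrightarrow> d i s = d i 0 + integral {0..s} (g i)"
    and "negligible N"
    and eq: "\<And>j s. j \<in> I \<Longrightarrow> s \<in> {0..T} - N \<Longrightarrow> g j s + (\<Sum>i\<in>I. A i j * c i s) = F j s"
  shows "((\<lambda>s. 2 * (\<Sum>j\<in>I. d j s * F j s)) has_integral energy t - energy 0) {0..t}"
proof -
  have sub: "{0..t} \<subseteq> {0..T}" "0 \<le> t" using t by auto
  have "((\<lambda>s. 2 * d i s * g i s) has_integral (d i t)\<^sup>2 - (d i 0)\<^sup>2) {0..t}" if "i \<in> I" for i
  proof (rule absolutely_continuous_square_has_integral)
    show "g i absolutely_integrable_on {0..t}"
      using set_integrable_subset[OF g[OF that] _ sub(1)] by auto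
    show "d i s = d i 0 + integral {0..s} (g i)" if "s \<in> {0..t}" for s
      using d[OF \<open>i \<in> I\<close>, of s] sub that by blast
  qed (use sub in auto)
  then have 1: "((\<lambda>s. \<Sum>i\<in>I. 2 * d i s * g i s) has_integral (\<Sum>i\<in>I. (d i t)\<^sup>2 - (d i 0)\<^sup>2)) {0..t}"
    by (intro has_integral_sum \<open>finite I\<close>)
  let ?q = "\<lambda>t. \<Sum>i\<in>I. \<Sum>j\<in>I. A i j * c i t * c j t"
  have 2: "((\<lambda>s. 2 * (\<Sum>j\<in>I. d j s * (\<Sum>i\<in>I. A i j * c i s))) has_integral ?q t - ?q 0) {0..t}"
  proof (rule fundamental_theorem_of_calculus[OF sub(2)])
    fix s assume "s \<in> {0..t}"
    with sub have "s \<in> {0..T}" by auto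
    then have "(?q has_real_derivative 2 * (\<Sum>j\<in>I. d j s * (\<Sum>i\<in>I. A i j * c i s))) (at s within {0..T})"
      by (intro quadratic_form_has_real_derivative sym c)
    then show "(?q has_vector_derivative 2 * (\<Sum>j\<in>I. d j s * (\<Sum>i\<in>I. A i j * c i s))) (at s within {0..t})"
      using sub by (auto simp: has_real_derivative_iff_has_vector_derivative[symmetric] intro: DERIV_subset)
  qed
  have "((\<lambda>s. (\<Sum>i\<in>I. 2 * d i s * g i s) + 2 * (\<Sum>j\<in>I. d j s * (\<Sum>i\<in>I. A i j * c i s)))
         has_integral energy t - energy 0) {0..t}"
    using has_integral_add[OF 1 2] by (simp add: energy_def sum_subtractf algebra_simps)
  then show ?thesis
  proof (rule has_integral_spike[OF \<open>negligible N\<close>, rotated])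
    fix s assume "s \<in> {0..t} - N"
    then have "\<And>j. j \<in> I \<Longrightarrow> F j s = g j s + (\<Sum>i\<in>I. A i j * c i s)"
      using eq sub by auto
    then show "2 * (\<Sum>j\<in>I. d j s * F j s) = (\<Sum>i\<in>I. 2 * d i s * g i s) + 2 * (\<Sum>j\<in>I. d j s * (\<Sum>i\<in>I. A i j * c i s))"
      by (simp add: sum_distrib_left distrib_left sum.distrib mult_ac)
  qed
qed

section \<open>Square-integrable functions and the Cauchy-Schwarz inequality\<close>

lemma integrable_mult_of_squares:
  fixes v w :: "'a \<Rightarrow> real"
  assumes [measurable]: "v \<in> borel_measurable M" "w \<in> borel_measurable M"
    and "integrable M (\<lambda>x. (v x)\<^sup>2)" "integrable M (\<lambda>x. (w x)\<^sup>2)"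
  shows "integrable M (\<lambda>x. v x * w x)"
proof (rule Bochner_Integration.integrable_bound)
  show "integrable M (\<lambda>x. (v x)\<^sup>2 + (w x)\<^sup>2)" using assms by auto
  have "\<bar>a * b\<bar> \<le> a\<^sup>2 + b\<^sup>2" for a b :: real
    using sum_squares_bound[of "\<bar>a\<bar>" "\<bar>b\<bar>"] abs_ge_zero[of "a * b"]
    unfolding abs_mult power2_abs by linarith
  then show "AE x in M. norm (v x * w x) \<le> norm ((v x)\<^sup>2 + (w x)\<^sup>2)" by auto
qed measurable

lemma Cauchy_Schwarz_integral:
  fixes v w :: "'a \<Rightarrow> real"
  assumes [measurable]: "v \<in> borel_measurable M" "w \<in> borel_measurable M"
    and v: "integrable M (\<lambda>x. (v x)\<^sup>2)" and w: "integrable M (\<lambda>x. (w x)\<^sup>2)"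
  shows "\<bar>\<integral>x. v x * w x \<partial>M\<bar> \<le> sqrt (\<integral>x. (v x)\<^sup>2 \<partial>M) * sqrt (\<integral>x. (w x)\<^sup>2 \<partial>M)"
proof -
  define a where "a = (\<integral>x. (v x)\<^sup>2 \<partial>M)"
  define b where "b = (\<integral>x. (w x)\<^sup>2 \<partial>M)"
  define p where "p = (\<integral>x. v x * w x \<partial>M)"
  have vw: "integrable M (\<lambda>x. v x * w x)" using assms by (rule integrable_mult_of_squares)
  have ab: "a \<ge> 0" "b \<ge> 0" by (auto simp: a_def b_def)
  \<comment> \<open>The classical discriminant argument: the integral of \<open>(l * w - v)\<close>
    squared is a quadratic polynomial in \<open>l\<close> that is never negative.\<close>
  have q: "0 \<le> b * l\<^sup>2 - 2 * l * p + a" for l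
  proof -
    have "0 \<le> (\<integral>x. (l * w x - v x)\<^sup>2 \<partial>M)" by simp
    also have "(\<lambda>x. (l * w x - v x)\<^sup>2) = (\<lambda>x. l\<^sup>2 * (w x)\<^sup>2 - (2 * l) * (v x * w x) + (v x)\<^sup>2)"
      by (auto simp: power2_eq_square algebra_simps)
    also have "(\<integral>x. l\<^sup>2 * (w x)\<^sup>2 - (2 * l) * (v x * w x) + (v x)\<^sup>2 \<partial>M) = l\<^sup>2 * b - (2 * l) * p + a"
      using v w vw by (simp add: a_def b_def p_def)
    finally show ?thesis by (simp add: algebra_simps)
  qed
  have "p\<^sup>2 \<le> a * b"
  proof (cases "b = 0")
    case True
    have "p = 0"
    proof (rule ccontr)
      assume "p \<noteq> 0"
      \<comment> \<open>If \<open>b = 0\<close>, the polynomial is \<open>a - 2 * l * p\<close>; at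
        this \<open>l\<close> it takes the value -1.\<close>
      then show False using q[of "(a + 1) / (2 * p)"] True by (simp add: field_simps)
    qed
    then show ?thesis using ab by simp
  next
    case False
    with ab have "b > 0" by simp
    then have "b * (p / b)\<^sup>2 - 2 * (p / b) * p + a = a - p\<^sup>2 / b"
      by (simp add: power2_eq_square field_simps)
    \<comment> \<open>The point \<open>p / b\<close> is the minimiser of the quadratic
      polynomial.\<close>
    then have "p\<^sup>2 / b \<le> a" using q[of "p / b"] by linarith
    with \<open>b > 0\<close> show ?thesis by (simp add: field_simps)
  qed
  then have "\<bar>p\<bar> \<le> sqrt (a * b)" using real_le_rsqrt[of "\<bar>p\<bar>"] by simp
  then show ?thesis by (simp add: a_def b_def p_def real_sqrt_mult)
qed

text \<open>Mediates between the almost-everywhere quantifier of Lebesgue measure and the negligible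
  sets that \<open>has_integral_spike\<close> allows one to ignore.\<close>

lemma AE_lebesgue_onE_negligible:
  fixes S :: "'a::euclidean_space set"
  assumes "AE x in lebesgue_on S. P x" "S \<in> sets lebesgue"
  obtains N where "negligible N" "\<And>x. x \<in> S - N \<Longrightarrow> P x"
proof -
  have "AE x in lebesgue. x \<in> S \<longrightarrow> P x"
    using assms by (subst (asm) AE_restrict_space_iff) auto
  then obtain N where "N \<in> null_sets lebesgue" "{x. \<not> (x \<in> S \<longrightarrow> P x)} \<subseteq> N"
    unfolding eventually_ae_filter by auto
  then show thesis using that[of N] by (auto simp: negligible_iff_null_sets)
qed

lemma L2_cmult: "v \<in> L2 U \<Longrightarrow> (\<lambda>x. c * v x) \<in> L2 U"
  by (auto simp: L2_def power_mult_distrib)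

lemma integrable_mult_L2:
  "v \<in> L2 U \<Longrightarrow> w \<in> L2 U \<Longrightarrow> integrable (lebesgue_on U) (\<lambda>x. v x * w x)"
  by (auto simp: L2_def intro: integrable_mult_of_squares)

lemma L2_add:
  assumes "v \<in> L2 U" "w \<in> L2 U"
  shows "(\<lambda>x. v x + w x) \<in> L2 U"
proof -
  have "integrable (lebesgue_on U) (\<lambda>x. (v x)\<^sup>2 + 2 * (v x * w x) + (w x)\<^sup>2)"
    using assms integrable_mult_L2[OF assms] by (auto simp: L2_def)
  then show ?thesis
    using assms by (auto simp: L2_def power2_sum algebra_simps)
qed

lemma L2_diff: "v \<in> L2 U \<Longrightarrow> w \<in> L2 U \<Longrightarrow> (\<lambda>x. v x - w x) \<in> L2 U"
  using L2_add[of v U "\<lambda>x. (-1) * w x"] L2_cmult[of w U "-1"] by simp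

lemma L2_zero: "(\<lambda>x. 0) \<in> L2 U"
  by (simp add: L2_def)

lemma L2_sum: "finite I \<Longrightarrow> (\<And>i. i \<in> I \<Longrightarrow> h i \<in> L2 U) \<Longrightarrow> (\<lambda>x. \<Sum>i\<in>I. c i * h i x) \<in> L2 U"
  by (induction I rule: finite_induct) (auto intro!: L2_zero L2_add L2_cmult)

lemma L2_inner_commute: "L2_inner U v w = L2_inner U w v"
  by (simp add: L2_inner_def mult.commute)

lemma L2_inner_cmult: "L2_inner U (\<lambda>x. c * v x) w = c * L2_inner U v w"
  by (simp add: L2_inner_def mult.assoc)

lemma L2_inner_add:
  "v \<in> L2 U \<Longrightarrow> v' \<in> L2 U \<Longrightarrow> w \<in> L2 U \<Longrightarrow>
    L2_inner U (\<lambda>x. v x + v' x) w = L2_inner U v w + L2_inner U v' w"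
  using integrable_mult_L2[of v U w] integrable_mult_L2[of v' U w]
  by (simp add: L2_inner_def distrib_right)

lemma L2_inner_diff:
  "v \<in> L2 U \<Longrightarrow> v' \<in> L2 U \<Longrightarrow> w \<in> L2 U \<Longrightarrow>
    L2_inner U (\<lambda>x. v x - v' x) w = L2_inner U v w - L2_inner U v' w"
  using integrable_mult_L2[of v U w] integrable_mult_L2[of v' U w]
  by (simp add: L2_inner_def left_diff_distrib)

lemma L2_inner_sum:
  "finite I \<Longrightarrow> (\<And>i. i \<in> I \<Longrightarrow> h i \<in> L2 U) \<Longrightarrow> w \<in> L2 U \<Longrightarrow>
    L2_inner U (\<lambda>x. \<Sum>i\<in>I. c i * h i x) w = (\<Sum>i\<in>I. c i * L2_inner U (h i) w)"
proof (induction I rule: finite_induct)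
  case empty
  then show ?case by (simp add: L2_inner_def)
next
  case (insert i I)
  then show ?case
    using L2_inner_add[of "\<lambda>x. c i * h i x" U "\<lambda>x. \<Sum>i\<in>I. c i * h i x" w]
    by (simp add: L2_sum L2_cmult L2_inner_cmult)
qed

lemma L2_norm_nonneg: "0 \<le> L2_norm U v"
  by (simp add: L2_norm_def)

lemma L2_norm_sq: "(L2_norm U v)\<^sup>2 = L2_inner U v v"
  by (simp add: L2_norm_def L2_inner_def power2_eq_square)

lemma L2_Cauchy_Schwarz:
  "v \<in> L2 U \<Longrightarrow> w \<in> L2 U \<Longrightarrow> \<bar>L2_inner U v w\<bar> \<le> L2_norm U v * L2_norm U w"
  by (auto simp: L2_inner_def L2_norm_def L2_def intro: Cauchy_Schwarz_integral)

section \<open>Orthonormal bases of finite-dimensional function spaces\<close>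

lemma fun_subspace_add: "fun_subspace V \<Longrightarrow> v \<in> V \<Longrightarrow> w \<in> V \<Longrightarrow> (\<lambda>x. v x + w x) \<in> V"
  and fun_subspace_cmult: "fun_subspace V \<Longrightarrow> v \<in> V \<Longrightarrow> (\<lambda>x. c * v x) \<in> V"
  and fun_subspace_zero: "fun_subspace V \<Longrightarrow> (\<lambda>x. 0) \<in> V"
  by (auto simp: fun_subspace_def)

lemma fun_subspace_sum:
  "finite I \<Longrightarrow> fun_subspace V \<Longrightarrow> (\<And>i. i \<in> I \<Longrightarrow> h i \<in> V) \<Longrightarrow> (\<lambda>x. \<Sum>i\<in>I. c i * h i x) \<in> V"
  by (induction I rule: finite_induct)
    (auto intro!: fun_subspace_zero fun_subspace_add fun_subspace_cmult)

text \<open>Induction on the spanning set. The remainder \<open>r\<close> of the new element after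
  projection is either the zero function, in which case \<open>E\<close> is kept, or is normalised
  and added to \<open>E\<close>. Functions stand for themselves rather than for classes modulo null
  sets, so it is \<open>definite\<close> that turns a remainder of norm zero into an exact
  expansion.\<close>

lemma Gram_Schmidt_L2:
  assumes V: "fun_subspace V" "V \<subseteq> L2 U"
    and definite: "\<forall>v\<in>V. L2_norm U v = 0 \<longrightarrow> v = (\<lambda>x. 0)"
    and "finite B" "B \<subseteq> V"
  shows "\<exists>E. finite E \<and> E \<subseteq> V \<and> (\<forall>e\<in>E. \<forall>e'\<in>E. L2_inner U e e' = (if e = e' then 1 else 0)) \<and>
    (\<forall>b\<in>B. b = (\<lambda>x. \<Sum>e\<in>E. L2_inner U b e * e x))"
  using \<open>finite B\<close> \<open>B \<subseteq> V\<close>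
proof (induction B rule: finite_induct)
  case empty
  show ?case by (rule exI[of _ "{}"]) simp
next
  case (insert b B)
  then have "B \<subseteq> V" by simp
  from insert.IH[OF this] obtain E where E: "finite E" "E \<subseteq> V"
    and on: "\<forall>e\<in>E. \<forall>e'\<in>E. L2_inner U e e' = (if e = e' then 1 else 0)"
    and sp: "\<forall>b\<in>B. b = (\<lambda>x. \<Sum>e\<in>E. L2_inner U b e * e x)"
    by (elim exE conjE)
  have EL: "e \<in> L2 U" if "e \<in> E" for e using that E V by auto
  have bV: "b \<in> V" "b \<in> L2 U" using insert V by auto
  define p where "p = (\<lambda>x. \<Sum>e\<in>E. L2_inner U b e * e x)"
  have pV: "p \<in> V" unfolding p_def using E by (intro fun_subspace_sum V) auto
  define r where "r = (\<lambda>x. b x - p x)"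
  have rV: "r \<in> V"
    using fun_subspace_add[OF V(1) bV(1) fun_subspace_cmult[OF V(1) pV, of "-1"]] by (simp add: r_def)
  have L: "p \<in> L2 U" "r \<in> L2 U" using pV rV V by auto
  have rE: "L2_inner U r e = 0" if "e \<in> E" for e
  proof -
    have "L2_inner U p e = (\<Sum>e'\<in>E. L2_inner U b e' * L2_inner U e' e)"
      unfolding p_def using E that EL by (intro L2_inner_sum) auto
    also have "\<dots> = (\<Sum>e'\<in>E. if e' = e then L2_inner U b e' else 0)"
      using on that by (intro sum.cong) auto
    also have "\<dots> = L2_inner U b e" using that E by simp
    finally show ?thesis using L2_inner_diff[OF bV(2) L(1) EL[OF that]] by (simp add: r_def)
  qed
  show ?case
  proof (cases "L2_norm U r = 0")
    case True
    then have "b = p" using definite rV True by (auto simp: r_def fun_eq_iff)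
    then show ?thesis using E on sp unfolding p_def by (intro exI[of _ E] conjI ballI) blast+
  next
    case False
    define n where "n = (\<lambda>x. inverse (L2_norm U r) * r x)"
    have nV: "n \<in> V" unfolding n_def by (intro fun_subspace_cmult V rV)
    have nL: "n \<in> L2 U" using nV V by auto
    have nE: "L2_inner U n e = 0" if "e \<in> E" for e
      using rE[OF that] by (simp add: n_def L2_inner_cmult)
    have En: "L2_inner U e n = 0" if "e \<in> E" for e
      using nE[OF that] L2_inner_commute[of U e n] by simp
    have "L2_inner U n r = inverse (L2_norm U r) * (L2_norm U r)\<^sup>2"
      unfolding n_def L2_norm_sq by (rule L2_inner_cmult)
    then have rn: "L2_inner U r n = L2_norm U r"
      using False L2_inner_commute[of U r n] by (simp add: power2_eq_square)
    have nn: "L2_inner U n n = 1"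
      using False rn L2_inner_cmult[of U "inverse (L2_norm U r)" r n] by (simp add: n_def[symmetric])
    \<comment> \<open>Otherwise the inner product of \<open>n\<close> with itself would be 0 as well
      as 1. This is needed to split off the new summand in sums over
      \<open>insert n E\<close>.\<close>
    have nE': "n \<notin> E" using nE nn by auto
    \<comment> \<open>Combinations of the old basis are orthogonal to \<open>n\<close>. This serves
      twice: for the projection \<open>p\<close>, with \<open>w = b\<close>, and for the earlier
      elements of \<open>B\<close>, with \<open>w = v\<close>, whose expansions therefore survive
      the enlargement of \<open>E\<close>.\<close>
    have combn: "L2_inner U v n = 0" if "v = (\<lambda>x. \<Sum>e\<in>E. L2_inner U w e * e x)" for v w
      using L2_inner_sum[of E "\<lambda>e. e" U n "\<lambda>e. L2_inner U w e"] E EL nL En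
      by (simp add: that)
    show ?thesis
    proof (intro exI[of _ "insert n E"] conjI ballI)
      show "finite (insert n E)" "insert n E \<subseteq> V" using E nV by auto
      fix e e' assume "e \<in> insert n E" "e' \<in> insert n E"
      then show "L2_inner U e e' = (if e = e' then 1 else 0)"
        using on nE En nE' by (auto simp: nn)
    next
      fix b' assume "b' \<in> insert b B"
      then show "b' = (\<lambda>x. \<Sum>e\<in>insert n E. L2_inner U b' e * e x)"
      proof
        assume "b' = b"
        have bn: "L2_inner U b n = L2_norm U r"
          using L2_inner_diff[OF bV(2) L(1) nL] rn combn[OF p_def] by (simp add: r_def)
        have bx: "b x = L2_norm U r * n x + p x" for x
          using False by (simp add: n_def r_def mult.assoc[symmetric])
        have "(\<Sum>e\<in>insert n E. L2_inner U b e * e x) = L2_norm U r * n x + p x" for x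
          using E nE' bn by (simp add: p_def)
        then show ?thesis
          unfolding \<open>b' = b\<close> by (intro ext trans[OF bx sym])
      next
        assume "b' \<in> B"
        then have "L2_inner U b' n = 0" using combn[OF bspec[OF sp]] by blast
        then have "(\<Sum>e\<in>insert n E. L2_inner U b' e * e x) = (\<Sum>e\<in>E. L2_inner U b' e * e x)" for x
          using E nE' by simp
        then show ?thesis using bspec[OF sp \<open>b' \<in> B\<close>] by presburger
      qed
    qed
  qed
qed

text \<open>Orthonormalise a finite spanning set. The coefficients \<open>L2_inner U v e\<close> are
  linear in \<open>v\<close>, so the expansion passes from the spanning set to all of
  \<open>V\<close> after exchanging the two finite sums.\<close>

lemma orthonormal_basis_L2:
  assumes V: "fun_subspace V" "fun_finite_dim V" "V \<subseteq> L2 U"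
    and definite: "\<forall>v\<in>V. L2_norm U v = 0 \<longrightarrow> v = (\<lambda>x. 0)"
  shows "\<exists>E. finite E \<and> E \<subseteq> V \<and> (\<forall>e\<in>E. \<forall>e'\<in>E. L2_inner U e e' = (if e = e' then 1 else 0)) \<and>
    (\<forall>v\<in>V. v = (\<lambda>x. \<Sum>e\<in>E. L2_inner U v e * e x))"
proof -
  obtain B where B: "finite B" "B \<subseteq> V" and span: "\<And>v. v \<in> V \<Longrightarrow> \<exists>c. v = (\<lambda>x. \<Sum>b\<in>B. c b * b x)"
    using V(2) unfolding fun_finite_dim_def by blast
  from Gram_Schmidt_L2[OF V(1,3) definite B] obtain E where E: "finite E" "E \<subseteq> V"
    and on: "\<forall>e\<in>E. \<forall>e'\<in>E. L2_inner U e e' = (if e = e' then 1 else 0)"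
    and sp: "\<forall>b\<in>B. b = (\<lambda>x. \<Sum>e\<in>E. L2_inner U b e * e x)"
    by (elim exE conjE)
  have "v = (\<lambda>x. \<Sum>e\<in>E. L2_inner U v e * e x)" if "v \<in> V" for v
  proof
    fix x
    obtain c where c: "v = (\<lambda>x. \<Sum>b\<in>B. c b * b x)" using span[OF \<open>v \<in> V\<close>] by blast
    have "L2_inner U v e = (\<Sum>b\<in>B. c b * L2_inner U b e)" if "e \<in> E" for e
      unfolding c using B E V that by (intro L2_inner_sum) auto
    then have "(\<Sum>e\<in>E. L2_inner U v e * e x) = (\<Sum>e\<in>E. \<Sum>b\<in>B. c b * L2_inner U b e * e x)"
      by (simp add: sum_distrib_right)
    also have "\<dots> = (\<Sum>b\<in>B. c b * (\<Sum>e\<in>E. L2_inner U b e * e x))"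
      by (subst sum.swap) (simp add: sum_distrib_left mult.assoc)
    also have "\<dots> = (\<Sum>b\<in>B. c b * b x)"
      using fun_cong[OF bspec[OF sp]] by (intro sum.cong) auto
    finally show "v x = (\<Sum>e\<in>E. L2_inner U v e * e x)" by (simp add: c)
  qed
  with E on show ?thesis by (intro exI[of _ E] conjI ballI) blast+
qed

section \<open>Piecewise functions as elements of the Lebesgue space on the domain\<close>

text \<open>Since \<open>v\<close> vanishes off the finite union \<open>W\<close> of open triangles,
  measurability (from continuity on \<open>W\<close>) and square-integrability (triangle by
  triangle) extend by zero to the whole plane and are then restricted to \<Omega>.\<close>

lemma H2_piecewise_in_L2:
  assumes "open \<Omega>" "finite \<T>" "v \<in> H2_piecewise \<T>"
  shows "v \<in> L2 \<Omega>"
proof -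
  define W where "W = (\<Union>K\<in>\<T>. interior K)"
  have off: "v x = 0" if "x \<notin> W" for x
    using assms(3) that by (auto simp: H2_piecewise_def vanishes_off_triangles_def W_def)
  have "open W" by (auto simp: W_def)
  then have Wm: "W \<in> sets lebesgue" "\<Omega> \<in> sets lebesgue" using assms(1) by auto
  have "continuous_on W v"
    unfolding W_def using assms(3) by (intro continuous_on_open_UN) (auto simp: H2_piecewise_def)
  then have "v \<in> borel_measurable (lebesgue_on W)"
    using Wm by (intro continuous_imp_measurable_on_sets_lebesgue)
  then have "(\<lambda>x. if x \<in> W then v x else 0) \<in> borel_measurable lebesgue"
    using Wm by (intro borel_measurable_if_I)
  also have "(\<lambda>x. if x \<in> W then v x else 0) = v" using off by auto
  finally have meas: "v \<in> borel_measurable (lebesgue_on \<Omega>)"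
    by (rule measurable_restrict_space1)
  have "set_integrable lebesgue W (\<lambda>x. (v x)\<^sup>2)"
    unfolding W_def
  proof (rule set_integrable_UN[OF assms(2)])
    fix K assume "K \<in> \<T>"
    then have "integrable (lebesgue_on (interior K)) (\<lambda>x. (v x)\<^sup>2)"
      using assms(3) by (auto simp: H2_piecewise_def sobolev_H_def L2_def)
    then show "set_integrable lebesgue (interior K) (\<lambda>x. (v x)\<^sup>2)"
      by (simp add: set_integrable_def integrable_restrict_space)
  qed auto
  moreover have "(\<lambda>x. indicator W x *\<^sub>R (v x)\<^sup>2) = (\<lambda>x. (v x)\<^sup>2)"
    using off by (fastforce simp: indicator_def fun_eq_iff)
  ultimately have "integrable lebesgue (\<lambda>x. (v x)\<^sup>2)" by (simp add: set_integrable_def)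
  then have "integrable (lebesgue_on \<Omega>) (\<lambda>x. (v x)\<^sup>2)"
    using Wm by (simp add: integrable_restrict_space integrable_mult_indicator del: real_scaleR_def)
  with meas show ?thesis by (simp add: L2_def)
qed

text \<open>A nonzero value at a point of an open triangle persists, by continuity, on an open
  neighbourhood, whereas a function of norm zero vanishes off a negligible subset of
  \<Omega>.\<close>

lemma H2_piecewise_L2_norm_definite:
  assumes "open \<Omega>" "finite \<T>" "\<Union>\<T> \<subseteq> closure \<Omega>" and v: "v \<in> H2_piecewise \<T>"
    and "L2_norm \<Omega> v = 0"
  shows "v = (\<lambda>x. 0)"
proof (rule ccontr)
  assume "v \<noteq> (\<lambda>x. 0)"
  then obtain x where x: "v x \<noteq> 0" by auto
  then obtain K where K: "K \<in> \<T>" "x \<in> interior K"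
    using v by (auto simp: H2_piecewise_def vanishes_off_triangles_def)
  have "integrable (lebesgue_on \<Omega>) (\<lambda>x. (v x)\<^sup>2)"
    using H2_piecewise_in_L2[OF assms(1,2) v] by (simp add: L2_def)
  then have "AE x in lebesgue_on \<Omega>. (v x)\<^sup>2 = 0"
    using \<open>L2_norm \<Omega> v = 0\<close> by (subst integral_nonneg_eq_0_iff_AE[symmetric]) (auto simp: L2_norm_def)
  then obtain N where N: "negligible N" "\<And>x. x \<in> \<Omega> - N \<Longrightarrow> (v x)\<^sup>2 = 0"
    using assms(1) by (auto elim!: AE_lebesgue_onE_negligible)
  define S where "S = interior K \<inter> v -` (- {0})"
  have "open S"
    unfolding S_def using v K
    by (intro continuous_open_preimage) (auto simp: H2_piecewise_def)
  \<comment> \<open>The triangle is only known to lie in the closure of \<Omega>; the open set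
    \<open>S\<close> contains a point of this closure and hence meets \<Omega> in a nonempty open
    set, which cannot be negligible.\<close>
  have "x \<in> S" "x \<in> closure \<Omega>"
    using x K assms(3) interior_subset by (auto simp: S_def)
  then have "S \<inter> \<Omega> \<noteq> {}"
    using \<open>open S\<close> by (metis disjoint_iff open_Int_closure_eq_empty)
  moreover have "S \<inter> \<Omega> \<subseteq> N" using N(2) by (auto simp: S_def)
  then have "negligible (S \<inter> \<Omega>)" using N(1) negligible_subset by blast
  ultimately show False
    using open_not_negligible \<open>open S\<close> assms(1) by blast
qed

section \<open>One-sided point values, the Morley space, and bilinearity on finite sums\<close>

text \<open>\<open>Lim\<close> is determined only along a nontrivial filter, so \<open>z\<close> has
  to be a limit point of the open triangle. It is one because a closed convex set with nonempty
  interior is the closure of its interior.\<close>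

lemma Lim_const_within_simplex:
  fixes K :: "plane set" and c :: "'b::t2_space"
  assumes "2 simplex K" "z \<in> K"
  shows "Lim (at z within interior K) (\<lambda>_. c) = c"
proof -
  have "convex K" using assms(1) by (auto simp: simplex_def)
  have "closed K" using assms(1) by (auto simp: simplex intro: compact_imp_closed finite_imp_compact_convex_hull)
  have "aff_dim K = 2" using assms(1) by (rule aff_dim_simplex)
  then have "interior K \<noteq> {}"
    using interior_rel_interior_gen[of K] rel_interior_eq_empty[OF \<open>convex K\<close>] assms(2) by auto
  then have "z \<in> closure (interior K)"
    using convex_closure_interior[OF \<open>convex K\<close>] \<open>closed K\<close> assms(2) by simp
  then have "z islimpt interior K"
    by (metis closure_def UnE mem_Collect_eq interior_limit_point interior_interior)
  then show ?thesis by (intro tendsto_Lim) (auto simp: trivial_limit_within)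
qed

text \<open>An edge is a polytope, hence the convex hull of its finitely many extreme points, and
  \<open>mid\<close> is their convex combination with equal weights.\<close>

lemma mid_edge_in_simplex:
  assumes "2 simplex K" "e edge_of K"
  shows "mid e \<in> K"
proof -
  have "polytope K" using assms(1) by (auto simp: simplex polytope_def)
  then have "polytope e" using assms(2) by (auto simp: edge_of_def intro: face_of_polytope_polytope)
  then have fin: "finite (vertices_of e)" and hull: "convex hull (vertices_of e) = e"
    using Krein_Milman_Minkowski[of e]
    by (simp_all add: vertices_of_def finite_polyhedron_extreme_points polytope_imp_polyhedron
        polytope_imp_compact polytope_imp_convex)
  have "e \<noteq> {}" using assms(2) by (auto simp: edge_of_def)
  then have "vertices_of e \<noteq> {}" using hull by auto
  then have "(\<Sum>z\<in>vertices_of e. (1 / real (card (vertices_of e))) *\<^sub>R z) \<in> convex hull (vertices_of e)"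
    using fin by (intro convex_sum convex_convex_hull) (auto intro: hull_inc)
  then have "mid e \<in> e" using hull by (simp add: mid_def scaleR_sum_right)
  then show ?thesis using edge_of_imp_subset[OF assms(2)] by auto
qed

text \<open>This puts \<open>V\<close> inside the sum of \<open>V\<close> and the Morley space, the
  set on which \<open>a\<^sub>h\<close> is known to be bilinear. The nodal conditions reduce to
  limits of constants at vertices and edge midpoints.\<close>

lemma zero_in_morley:
  assumes simp: "\<And>K. K \<in> \<T> \<Longrightarrow> 2 simplex K"
  shows "(\<lambda>x. 0) \<in> morley \<Omega> \<T>"
proof -
  have "(\<lambda>x. 0) \<in> polynomials r" for r
    by (auto simp: polynomials_def intro!: exI[of _ "\<lambda>i j. 0"])
  moreover have "grad (\<lambda>x. 0) = (\<lambda>x. 0)"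
    by (auto simp: grad_def pderiv1_def vec_eq_iff frechet_derivative_const)
  ultimately show ?thesis
    using simp mid_edge_in_simplex[OF simp]
    by (auto simp: morley_def P_piecewise_def vanishes_off_triangles_def value_on_def grad_on_def
        patch_def Lim_const_within_simplex)
qed

lemma bilinear_sum_left:
  assumes b: "symmetric_bilinear_on S b" and V: "fun_subspace V" "V \<subseteq> S"
    and "finite I" "\<And>i. i \<in> I \<Longrightarrow> h i \<in> V" "w \<in> V"
  shows "b (\<lambda>x. \<Sum>i\<in>I. c i * h i x) w = (\<Sum>i\<in>I. c i * b (h i) w)"
  using assms(4,5)
proof (induction I rule: finite_induct)
  case empty
  \<comment> \<open>The empty sum is the zero function, written as \<open>0 * w x\<close> so that
    homogeneity applies.\<close>
  have "b (\<lambda>x. 0 * w x) w = 0 * b w w"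
    using b V \<open>w \<in> V\<close> unfolding symmetric_bilinear_on_def by blast
  then show ?case by simp
next
  case (insert i I)
  have "(\<lambda>x. c i * h i x) \<in> V" "(\<lambda>x. \<Sum>i\<in>I. c i * h i x) \<in> V"
    using insert V by (auto intro!: fun_subspace_sum fun_subspace_cmult)
  moreover have "b (\<lambda>x. v x + v' x) w = b v w + b v' w" if "v \<in> V" "v' \<in> V" for v v'
    using b V \<open>w \<in> V\<close> that unfolding symmetric_bilinear_on_def by blast
  ultimately have "b (\<lambda>x. c i * h i x + (\<Sum>i\<in>I. c i * h i x)) w =
      b (\<lambda>x. c i * h i x) w + b (\<lambda>x. \<Sum>i\<in>I. c i * h i x) w"
    by blast
  moreover have "b (\<lambda>x. c i * h i x) w = c i * b (h i) w"
    using b V \<open>w \<in> V\<close> insert.prems unfolding symmetric_bilinear_on_def by blast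
  ultimately show ?case using insert by simp
qed

section \<open>Scalar functions of time obtained from functions with values in a Lebesgue
  space\<close>

text \<open>Pairing the approximating simple functions with \<open>\<phi>\<close> gives scalar
  simple functions that converge almost everywhere by Cauchy-Schwarz, whence measurability. The
  pairing is dominated by the sum of the squared norms of \<open>g t\<close> and
  \<open>\<phi>\<close>, which is integrable on the bounded interval.\<close>

lemma L2_L2_inner_integrable:
  assumes g: "g \<in> L2_L2 T \<Omega>" and \<phi>: "\<phi> \<in> L2 \<Omega>"
  shows "integrable (lebesgue_on {0..T}) (\<lambda>t. L2_inner \<Omega> (g t) \<phi>)"
proof -
  let ?M = "lebesgue_on {0..T}"
  obtain s where s: "\<And>n. simple_function ?M (s n)" "\<And>n t. t \<in> {0..T} \<Longrightarrow> s n t \<in> L2 \<Omega>"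
    and lim: "AE t in ?M. g t \<in> L2 \<Omega> \<and> (\<lambda>n. L2_norm \<Omega> (\<lambda>x. s n t x - g t x)) \<longlonglongrightarrow> 0"
    and sq: "integrable ?M (\<lambda>t. (L2_norm \<Omega> (g t))\<^sup>2)"
    using g unfolding L2_L2_def by blast
  obtain N where N: "negligible N" "\<And>t. t \<in> {0..T} - N \<Longrightarrow>
      g t \<in> L2 \<Omega> \<and> (\<lambda>n. L2_norm \<Omega> (\<lambda>x. s n t x - g t x)) \<longlonglongrightarrow> 0"
    using AE_lebesgue_onE_negligible[OF lim] by auto
  have Nm: "N \<in> sets lebesgue" using N(1) by (simp add: negligible_imp_sets)
  \<comment> \<open>The value 0 off \<open>{0..T} - N\<close> makes \<open>k n\<close> converge to
    \<open>k'\<close> at every time, as \<open>borel_measurable_LIMSEQ_real\<close>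
    requires.\<close>
  define k where "k = (\<lambda>n t. if t \<in> {0..T} - N then L2_inner \<Omega> (s n t) \<phi> else 0)"
  define k' where "k' = (\<lambda>t. if t \<in> {0..T} - N then L2_inner \<Omega> (g t) \<phi> else 0)"
  have km: "k n \<in> borel_measurable lebesgue" for n
  proof -
    \<comment> \<open>A simple function takes finitely many values on measurable sets, so its
      composition with any map is simple; no measurable structure on the function space
      enters.\<close>
    have "simple_function ?M (\<lambda>t. L2_inner \<Omega> (s n t) \<phi>)"
      using simple_function_compose[OF s(1)[of n], of "\<lambda>v. L2_inner \<Omega> v \<phi>"] by (simp add: comp_def)
    then have "(\<lambda>t. if t \<in> {0..T} then L2_inner \<Omega> (s n t) \<phi> else 0) \<in> borel_measurable lebesgue"
      by (intro borel_measurable_if_I borel_measurable_simple_function) auto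
    then have "(\<lambda>t. if t \<in> N then 0 else (if t \<in> {0..T} then L2_inner \<Omega> (s n t) \<phi> else 0))
        \<in> borel_measurable lebesgue"
      using Nm by (intro measurable_If_set[where A = N]) simp_all
    also have "(\<lambda>t. if t \<in> N then 0 else (if t \<in> {0..T} then L2_inner \<Omega> (s n t) \<phi> else 0)) = k n"
      by (auto simp: k_def)
    finally show ?thesis .
  qed
  have k'm: "k' \<in> borel_measurable lebesgue"
  proof (rule borel_measurable_LIMSEQ_real[OF _ km])
    fix t
    show "(\<lambda>n. k n t) \<longlonglongrightarrow> k' t"
    proof (cases "t \<in> {0..T} - N")
      case True
      then have gt: "g t \<in> L2 \<Omega>" and st: "\<And>n. s n t \<in> L2 \<Omega>"
        and l: "(\<lambda>n. L2_norm \<Omega> (\<lambda>x. s n t x - g t x)) \<longlonglongrightarrow> 0"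
        using N s by auto
      have lim0: "(\<lambda>n. L2_norm \<Omega> (\<lambda>x. s n t x - g t x) * L2_norm \<Omega> \<phi>) \<longlonglongrightarrow> 0"
        using tendsto_mult_left_zero[OF l] .
      have "norm (L2_inner \<Omega> (s n t) \<phi> - L2_inner \<Omega> (g t) \<phi>) \<le>
          L2_norm \<Omega> (\<lambda>x. s n t x - g t x) * L2_norm \<Omega> \<phi>" for n
        using L2_Cauchy_Schwarz[OF L2_diff[OF st gt] \<phi>] by (simp add: L2_inner_diff st gt \<phi>)
      then have "(\<lambda>n. L2_inner \<Omega> (s n t) \<phi> - L2_inner \<Omega> (g t) \<phi>) \<longlonglongrightarrow> 0"
        by (intro Lim_null_comparison[OF always_eventually lim0] allI)
      then show ?thesis
        using True by (simp add: k_def k'_def LIM_zero_iff)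
    next
      case False
      then show ?thesis by (auto simp: k_def k'_def)
    qed
  qed
  have ki: "integrable ?M k'"
  proof (rule Bochner_Integration.integrable_bound)
    show "integrable ?M (\<lambda>t. (L2_norm \<Omega> (g t))\<^sup>2 + (L2_norm \<Omega> \<phi>)\<^sup>2)"
      using sq by (auto intro!: Bochner_Integration.integrable_add finite_measure.integrable_const
          finite_measure_lebesgue_on)
    show "k' \<in> borel_measurable ?M" using k'm by (rule measurable_restrict_space1)
    have "\<bar>k' t\<bar> \<le> (L2_norm \<Omega> (g t))\<^sup>2 + (L2_norm \<Omega> \<phi>)\<^sup>2" for t
    proof (cases "t \<in> {0..T} - N")
      case True
      then have "\<bar>k' t\<bar> \<le> L2_norm \<Omega> (g t) * L2_norm \<Omega> \<phi>"
        using L2_Cauchy_Schwarz[OF _ \<phi>] N by (simp add: k'_def)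
      also have "\<dots> \<le> 2 * L2_norm \<Omega> (g t) * L2_norm \<Omega> \<phi>"
        by (simp add: L2_norm_nonneg)
      finally show ?thesis
        using sum_squares_bound[of "L2_norm \<Omega> (g t)" "L2_norm \<Omega> \<phi>"] by linarith
    qed (auto simp: k'_def)
    then show "AE t in ?M. norm (k' t) \<le> norm ((L2_norm \<Omega> (g t))\<^sup>2 + (L2_norm \<Omega> \<phi>)\<^sup>2)"
      by simp
  qed
  \<comment> \<open>On \<open>{0..T}\<close>, \<open>k'\<close> differs from the pairing only within
    \<open>N\<close>, so integrability transfers back; measurability does too because Lebesgue
    measure is complete.\<close>
  have "AE t in lebesgue. t \<notin> N"
    using N(1) by (auto intro: AE_not_in simp: negligible_iff_null_sets)
  then have ae: "AE t in lebesgue.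
      (if t \<in> {0..T} then k' t else 0) = (if t \<in> {0..T} then L2_inner \<Omega> (g t) \<phi> else 0)"
    by (auto simp: k'_def elim!: eventually_mono)
  have ki': "integrable lebesgue (\<lambda>t. if t \<in> {0..T} then k' t else 0)"
    using ki by (subst Lebesgue_Measure.integrable_restrict_UNIV) auto
  have "integrable lebesgue (\<lambda>t. if t \<in> {0..T} then L2_inner \<Omega> (g t) \<phi> else 0)"
    by (rule integrable_cong_AE_imp[OF ki' borel_measurable_AE[OF borel_measurable_integrable[OF ki'] ae]])
      (rule ae)
  then show ?thesis by (subst (asm) Lebesgue_Measure.integrable_restrict_UNIV) auto
qed

text \<open>Cauchy-Schwarz in time against the constant 1, whose norm on \<open>{0..T}\<close> is
  \<open>sqrt T\<close>.\<close>

lemma L2_L2_norm_integrable: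
  assumes "0 \<le> T" and f: "f \<in> L2_L2 T \<Omega>"
  shows "integrable (lebesgue_on {0..T}) (\<lambda>t. L2_norm \<Omega> (f t))"
    and "(\<integral>t. L2_norm \<Omega> (f t) \<partial>lebesgue_on {0..T}) \<le> sqrt T * L2_L2_norm T \<Omega> f"
proof -
  let ?M = "lebesgue_on {0..T}"
  have sq: "integrable ?M (\<lambda>t. (L2_norm \<Omega> (f t))\<^sup>2)"
    using f unfolding L2_L2_def by blast
  then have [measurable]: "(\<lambda>t. (L2_norm \<Omega> (f t))\<^sup>2) \<in> borel_measurable ?M"
    by (rule borel_measurable_integrable)
  \<comment> \<open>The integrability of the squared norm gives measurability of the square; the
    norm itself is recovered as its root.\<close>
  have "(\<lambda>t. sqrt ((L2_norm \<Omega> (f t))\<^sup>2)) \<in> borel_measurable ?M"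
    by measurable
  then have m: "(\<lambda>t. L2_norm \<Omega> (f t)) \<in> borel_measurable ?M"
    by (simp add: L2_norm_nonneg)
  have one: "integrable ?M (\<lambda>t. 1\<^sup>2 :: real)"
    by (auto intro: finite_measure.integrable_const finite_measure_lebesgue_on)
  show "integrable ?M (\<lambda>t. L2_norm \<Omega> (f t))"
    using integrable_mult_of_squares[OF _ m one sq] by simp
  have "(\<integral>t. L2_norm \<Omega> (f t) \<partial>?M) \<le> sqrt (\<integral>t. 1\<^sup>2 \<partial>?M) * L2_L2_norm T \<Omega> f"
    using Cauchy_Schwarz_integral[OF _ m one sq] by (simp add: L2_L2_norm_def)
  also have "(\<integral>t. 1\<^sup>2 \<partial>?M) = T"
    using assms(1) by (simp add: measure_restrict_space)
  finally show "(\<integral>t. L2_norm \<Omega> (f t) \<partial>?M) \<le> sqrt T * L2_L2_norm T \<Omega> f" .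
qed

text \<open>The error of the scalar difference quotient is the pairing of the error
  \<open>?q s\<close> with \<open>\<phi>\<close>, which Cauchy-Schwarz bounds by a null
  function.\<close>

lemma has_time_derivative_inner:
  assumes "has_time_derivative T \<Omega> u d t" "\<phi> \<in> L2 \<Omega>" "d \<in> L2 \<Omega>" "t \<in> {0..T}"
    and u: "\<And>s. s \<in> {0..T} \<Longrightarrow> u s \<in> L2 \<Omega>"
  shows "((\<lambda>s. L2_inner \<Omega> (u s) \<phi>) has_real_derivative L2_inner \<Omega> d \<phi>) (at t within {0..T})"
proof -
  let ?q = "\<lambda>s x. (u s x - u t x) / (s - t) - d x"
  have lim0: "((\<lambda>s. L2_norm \<Omega> (?q s) * L2_norm \<Omega> \<phi>) \<longlongrightarrow> 0) (at t within {0..T})"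
    using assms(1) by (intro tendsto_mult_left_zero) (simp add: has_time_derivative_def)
  \<comment> \<open>The estimate includes \<open>s = t\<close>: there both quotients are 0 by the
    convention for division by zero.\<close>
  have bound: "norm ((L2_inner \<Omega> (u s) \<phi> - L2_inner \<Omega> (u t) \<phi>) / (s - t) - L2_inner \<Omega> d \<phi>)
      \<le> L2_norm \<Omega> (?q s) * L2_norm \<Omega> \<phi>" if "s \<in> {0..T}" for s
  proof -
    have L: "(\<lambda>x. u s x - u t x) \<in> L2 \<Omega>" using u that assms by (intro L2_diff) auto
    then have L': "(\<lambda>x. (1 / (s - t)) * (u s x - u t x)) \<in> L2 \<Omega>" by (rule L2_cmult)
    have "?q s = (\<lambda>x. (1 / (s - t)) * (u s x - u t x) - d x)" by auto
    then have "L2_inner \<Omega> (?q s) \<phi> =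
        (1 / (s - t)) * (L2_inner \<Omega> (u s) \<phi> - L2_inner \<Omega> (u t) \<phi>) - L2_inner \<Omega> d \<phi>"
      using L2_inner_diff[OF L' assms(3,2)] L2_inner_cmult[of \<Omega> "1 / (s - t)" "\<lambda>x. u s x - u t x" \<phi>]
        L2_inner_diff[of "u s" \<Omega> "u t" \<phi>] u that assms by simp
    moreover have "?q s \<in> L2 \<Omega>" using L2_diff[OF L' assms(3)] by simp
    ultimately show ?thesis using L2_Cauchy_Schwarz[of "?q s" \<Omega> \<phi>] assms(2) by simp
  qed
  have "((\<lambda>s. (L2_inner \<Omega> (u s) \<phi> - L2_inner \<Omega> (u t) \<phi>) / (s - t) - L2_inner \<Omega> d \<phi>) \<longlongrightarrow> 0)
      (at t within {0..T})"
    by (rule Lim_null_comparison[OF _ lim0]) (use bound in \<open>auto simp: eventually_at_filter\<close>)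
  then show ?thesis
    by (simp add: has_field_derivative_iff LIM_zero_iff)
qed

section \<open>The energy identity for semidiscrete solutions\<close>

text \<open>An orthonormal basis of \<open>V\<close> turns the problem into the scalar system of
  \<open>energy_identity\<close>. The function \<open>p\<close> is the power of the load, the inner
  product of \<open>f\<close> with the velocity, changed on a negligible set so that its bound holds
  at every time.\<close>

lemma semidiscrete_energy:
  assumes "0 < T"
    and V: "fun_subspace V" "fun_finite_dim V" "V \<subseteq> L2 \<Omega>"
    and definite: "\<forall>v\<in>V. L2_norm \<Omega> v = 0 \<longrightarrow> v = (\<lambda>x. 0)"
    and a: "symmetric_bilinear_on S a\<^sub>h" "V \<subseteq> S"
    and f: "f \<in> L2_L2 T \<Omega>"
    and sol: "semidiscrete_solution T \<Omega> V a\<^sub>h f w\<^sub>0 w\<^sub>1 u ut utt"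
  obtains p where "continuous_on {0..T} (\<lambda>t. L2_norm \<Omega> (ut t))"
    and "\<And>t. t \<in> {0..T} \<Longrightarrow> \<bar>p t\<bar> \<le> L2_norm \<Omega> (f t) * L2_norm \<Omega> (ut t)"
    and "\<And>t. t \<in> {0..T} \<Longrightarrow> ((\<lambda>s. 2 * p s) has_integral
           ((L2_norm \<Omega> (ut t))\<^sup>2 + a\<^sub>h (u t) (u t)) - ((L2_norm \<Omega> (ut 0))\<^sup>2 + a\<^sub>h (u 0) (u 0))) {0..t}"
proof -
  from orthonormal_basis_L2[OF V definite] obtain E where E: "finite E" "E \<subseteq> V"
    and expand: "\<forall>v\<in>V. v = (\<lambda>x. \<Sum>e\<in>E. L2_inner \<Omega> v e * e x)"
    by (elim exE conjE)
  have EL: "e \<in> L2 \<Omega>" if "e \<in> E" for e using that E V by auto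
  have uV: "u t \<in> V" "ut t \<in> V" if "t \<in> {0..T}" for t
    using sol that unfolding semidiscrete_solution_def by blast+
  have uL: "u t \<in> L2 \<Omega>" "ut t \<in> L2 \<Omega>" if "t \<in> {0..T}" for t
    using uV[OF that] V by auto
  \<comment> \<open>Only \<open>v\<close> is expanded, so \<open>w\<close> may be any element of
    \<open>L2 \<Omega>\<close>; this is used both for the velocity and for the load.\<close>
  have parseval: "L2_inner \<Omega> w v = (\<Sum>e\<in>E. L2_inner \<Omega> v e * L2_inner \<Omega> w e)"
    if "v \<in> V" "w \<in> L2 \<Omega>" for v w
  proof -
    have "L2_inner \<Omega> w v = L2_inner \<Omega> (\<lambda>x. \<Sum>e\<in>E. L2_inner \<Omega> v e * e x) w"
      unfolding L2_inner_commute[of \<Omega> w] by (rule arg_cong[OF bspec[OF expand that(1)]])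
    also have "\<dots> = (\<Sum>e\<in>E. L2_inner \<Omega> v e * L2_inner \<Omega> e w)"
      using E EL that by (intro L2_inner_sum) auto
    finally show ?thesis by (simp add: L2_inner_commute[of \<Omega> w])
  qed
  have form: "a\<^sub>h v w = (\<Sum>e\<in>E. L2_inner \<Omega> v e * a\<^sub>h e w)" if "v \<in> V" "w \<in> V" for v w
  proof -
    have "a\<^sub>h v w = a\<^sub>h (\<lambda>x. \<Sum>e\<in>E. L2_inner \<Omega> v e * e x) w"
      by (rule arg_cong[OF bspec[OF expand that(1)], of "\<lambda>v'. a\<^sub>h v' w"])
    also have "\<dots> = (\<Sum>e\<in>E. L2_inner \<Omega> v e * a\<^sub>h e w)"
      using that E by (intro bilinear_sum_left[OF a(1) V(1) a(2)]) auto
    finally show ?thesis .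
  qed
  have asym: "a\<^sub>h v w = a\<^sub>h w v" if "v \<in> V" "w \<in> V" for v w
    using a that unfolding symmetric_bilinear_on_def by blast
  \<comment> \<open>As pairings with basis elements, these coordinates satisfy scalar versions of
    the conditions on the solution: \<open>c\<close> has derivative \<open>d\<close>, and
    \<open>d\<close> is an indefinite integral of \<open>g\<close>.\<close>
  define c where "c = (\<lambda>e t. L2_inner \<Omega> (u t) e)"
  define d where "d = (\<lambda>e t. L2_inner \<Omega> (ut t) e)"
  define g where "g = (\<lambda>e t. L2_inner \<Omega> (utt t) e)"
  have gi: "integrable (lebesgue_on {0..T}) (g e)" if "e \<in> E" for e
    unfolding g_def
    by (rule L2_L2_inner_integrable[OF _ EL[OF that]]) (use sol in \<open>simp add: semidiscrete_solution_def\<close>)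
  have ga: "g e absolutely_integrable_on {0..T}" if "e \<in> E" for e
    using gi[OF that] by (simp add: set_integrable_def integrable_restrict_space)
  have dint: "d e t = d e 0 + integral {0..t} (g e)" if "e \<in> E" "t \<in> {0..T}" for e t
  proof -
    have "g e absolutely_integrable_on {0..t}"
      by (rule set_integrable_subset[OF ga[OF that(1)]]) (use that in auto)
    then have "integrable (lebesgue_on {0..t}) (g e)"
      by (simp add: set_integrable_def integrable_restrict_space)
    then have "(\<integral>s. g e s \<partial>lebesgue_on {0..t}) = integral {0..t} (g e)"
      by (intro lebesgue_integral_eq_integral) auto
    moreover have "d e t = d e 0 + (\<integral>s. g e s \<partial>lebesgue_on {0..t})"
      using sol EL[OF that(1)] that(2) unfolding semidiscrete_solution_def d_def g_def by blast
    ultimately show ?thesis by simp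
  qed
  have cder: "(c e has_real_derivative d e t) (at t within {0..T})" if "e \<in> E" "t \<in> {0..T}" for e t
  proof -
    have "has_time_derivative T \<Omega> u (ut t) t"
      using sol that(2) unfolding semidiscrete_solution_def by blast
    then show ?thesis
      unfolding c_def d_def using that EL uL by (intro has_time_derivative_inner) auto
  qed
  have "AE t in lebesgue_on {0..T}. f t \<in> L2 \<Omega> \<and>
      (\<forall>v\<in>V. L2_inner \<Omega> (utt t) v + a\<^sub>h (u t) v = L2_inner \<Omega> (f t) v)"
  proof (rule AE_conjI)
    show "AE t in lebesgue_on {0..T}. f t \<in> L2 \<Omega>"
      using f unfolding L2_L2_def by (auto elim: eventually_mono)
  qed (use sol in \<open>simp add: semidiscrete_solution_def\<close>)
  then obtain N where N: "negligible N"
    and fN: "\<And>t. t \<in> {0..T} - N \<Longrightarrow> f t \<in> L2 \<Omega>"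
    and eqN: "\<And>t v. t \<in> {0..T} - N \<Longrightarrow> v \<in> V \<Longrightarrow>
        L2_inner \<Omega> (utt t) v + a\<^sub>h (u t) v = L2_inner \<Omega> (f t) v"
    by (elim AE_lebesgue_onE_negligible) auto
  \<comment> \<open>\<open>f t\<close> is known to be square-integrable only off \<open>N\<close>;
    the value 0 on \<open>N\<close> keeps the Cauchy-Schwarz bound valid there.\<close>
  define p where "p = (\<lambda>t. if t \<in> N then 0 else L2_inner \<Omega> (f t) (ut t))"
  define energy where "energy = (\<lambda>t. (\<Sum>e\<in>E. (d e t)\<^sup>2) + (\<Sum>e\<in>E. \<Sum>e'\<in>E. a\<^sub>h e e' * c e t * c e' t))"
  have norm_ut: "(L2_norm \<Omega> (ut t))\<^sup>2 = (\<Sum>e\<in>E. (d e t)\<^sup>2)" if "t \<in> {0..T}" for t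
    using parseval[OF uV(2)[OF that] uL(2)[OF that]] 
    unfolding L2_norm_sq d_def by (simp add: power2_eq_square)
  have energy: "energy t = (L2_norm \<Omega> (ut t))\<^sup>2 + a\<^sub>h (u t) (u t)" if "t \<in> {0..T}" for t
  proof -
    have "a\<^sub>h (u t) (u t) = (\<Sum>e\<in>E. c e t * a\<^sub>h (u t) e)"
      using form[OF uV(1)[OF that] uV(1)[OF that]] asym[OF _ uV(1)[OF that]] E
      by (simp add: c_def subset_iff)
    also have "\<dots> = (\<Sum>e\<in>E. \<Sum>e'\<in>E. c e t * (c e' t * a\<^sub>h e' e))"
      using form[OF uV(1)[OF that]] E by (simp add: c_def subset_iff sum_distrib_left)
    also have "\<dots> = (\<Sum>e\<in>E. \<Sum>e'\<in>E. a\<^sub>h e e' * c e t * c e' t)"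
      using asym E by (intro sum.cong refl) (auto simp: subset_iff)
    finally show ?thesis using norm_ut[OF that] by (simp add: energy_def)
  qed
  show thesis
  proof
    \<comment> \<open>By Parseval the norm of the velocity is the Euclidean norm of its coordinates,
      which are continuous as indefinite integrals.\<close>
    have "continuous_on {0..T} (\<lambda>t. sqrt (\<Sum>e\<in>E. (d e t)\<^sup>2))"
    proof (intro continuous_intros)
      fix e assume "e \<in> E"
      then have "continuous_on {0..T} (\<lambda>t. d e 0 + integral {0..t} (g e))"
        using ga by (intro continuous_intros indefinite_integral_continuous_1)
          (auto simp: absolutely_integrable_on_def)
      then show "continuous_on {0..T} (d e)"
        by (rule continuous_on_eq) (use dint[OF \<open>e \<in> E\<close>] in metis)
    qed
    then show "continuous_on {0..T} (\<lambda>t. L2_norm \<Omega> (ut t))"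
      by (rule continuous_on_eq) (simp add: norm_ut[symmetric] L2_norm_nonneg)
  next
    fix t assume t: "t \<in> {0..T}"
    show "\<bar>p t\<bar> \<le> L2_norm \<Omega> (f t) * L2_norm \<Omega> (ut t)"
      using L2_Cauchy_Schwarz[OF fN uL(2)] t by (auto simp: p_def L2_norm_nonneg)
    have "((\<lambda>s. 2 * (\<Sum>e\<in>E. d e s * L2_inner \<Omega> (f s) e)) has_integral energy t - energy 0) {0..t}"
      unfolding energy_def
    proof (rule energy_identity[OF E(1) t _ cder ga dint N])
      show "a\<^sub>h e e' = a\<^sub>h e' e" if "e \<in> E" "e' \<in> E" for e e' using asym that E by auto
      fix e s assume "e \<in> E" and s: "s \<in> {0..T} - N"
      have "a\<^sub>h (u s) e = (\<Sum>e'\<in>E. a\<^sub>h e' e * c e' s)"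
        using form[of "u s" e] uV s \<open>e \<in> E\<close> E by (auto simp: c_def mult.commute)
      then show "g e s + (\<Sum>e'\<in>E. a\<^sub>h e' e * c e' s) = L2_inner \<Omega> (f s) e"
        using eqN[OF s, of e] \<open>e \<in> E\<close> E by (auto simp: g_def)
    qed
    then have "((\<lambda>s. 2 * p s) has_integral energy t - energy 0) {0..t}"
    proof (rule has_integral_spike[OF N, rotated])
      fix s assume s: "s \<in> {0..t} - N"
      then show "2 * p s = 2 * (\<Sum>e\<in>E. d e s * L2_inner \<Omega> (f s) e)"
        using parseval[OF uV(2) fN, of s s] t by (simp add: p_def d_def)
    qed
    then show "((\<lambda>s. 2 * p s) has_integral
           ((L2_norm \<Omega> (ut t))\<^sup>2 + a\<^sub>h (u t) (u t)) - ((L2_norm \<Omega> (ut 0))\<^sup>2 + a\<^sub>h (u 0) (u 0))) {0..t}"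
      using energy[of t] energy[of 0] t by simp
  qed
qed

section \<open>The stability estimate\<close>

text \<open>At the maximum of \<open>y\<close> the hypothesis is a quadratic inequality for that maximum; this
  replaces Gronwall's lemma.\<close>

lemma quadratic_energy_bound:
  fixes y q :: "real \<Rightarrow> real"
  assumes "0 \<le> T" "continuous_on {0..T} y" "0 \<le> k" "0 \<le> r" "t \<in> {0..T}"
    and q: "\<And>t. t \<in> {0..T} \<Longrightarrow> 0 \<le> q t"
    and bound: "\<And>t m. t \<in> {0..T} \<Longrightarrow> (\<And>s. s \<in> {0..T} \<Longrightarrow> y s \<le> m) \<Longrightarrow>
      (y t)\<^sup>2 + q t \<le> r\<^sup>2 + 2 * m * k"
  shows "(y t)\<^sup>2 + q t \<le> (r + 2 * k)\<^sup>2"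
proof -
  obtain s where s: "s \<in> {0..T}" "\<And>t. t \<in> {0..T} \<Longrightarrow> y t \<le> y s"
    using continuous_attains_sup[of "{0..T}" y] assms(1,2) by auto
  have "(y s)\<^sup>2 \<le> r\<^sup>2 + 2 * y s * k" using bound[OF s] q[OF s(1)] by simp
  \<comment> \<open>Completing the square bounds the maximum of \<open>y\<close> by
    \<open>r + 2 * k\<close> without computing the root of the quadratic.\<close>
  then have "(y s - k)\<^sup>2 \<le> r\<^sup>2 + k\<^sup>2" by (simp add: power2_diff)
  also have "\<dots> \<le> (r + k)\<^sup>2" using assms(3,4) by (simp add: power2_sum)
  finally have "y s - k \<le> r + k" by (rule power2_le_imp_le) (use assms(3,4) in simp)
  then have "y s \<le> r + 2 * k" by simp
  \<comment> \<open>The hypothesis is applied a second time, now with \<open>m = r + 2 * k\<close>;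
    this is why it is stated for every upper bound \<open>m\<close> of \<open>y\<close>.\<close>
  then have "(y t)\<^sup>2 + q t \<le> r\<^sup>2 + 2 * (r + 2 * k) * k"
    using bound[OF assms(5), of "r + 2 * k"] s(2) by fastforce
  also have "\<dots> \<le> (r + 2 * k)\<^sup>2"
    using assms(3,4) by (simp add: power2_eq_square algebra_simps)
  finally show ?thesis .
qed

lemma norm_h_nonneg: "0 \<le> norm_h \<Omega> \<T> v"
  unfolding norm_h_def H2_seminorm_sq_def
  by (intro real_sqrt_ge_zero add_nonneg_nonneg sum_nonneg divide_nonneg_nonneg zero_le_power2)

lemma semidiscrete_stability:
  assumes "0 < \<alpha>" "0 < \<beta>" "0 < T"
    and "open \<Omega>" and \<T>: "finite \<T>" "\<And>K. K \<in> \<T> \<Longrightarrow> 2 simplex K" "\<Union>\<T> \<subseteq> closure \<Omega>"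
    and V: "discrete_space \<T> V"
    and a: "discrete_form \<alpha> \<beta> \<Omega> \<T> V a\<^sub>h"
    and f: "f \<in> L2_L2 T \<Omega>"
    and sol: "semidiscrete_solution T \<Omega> V a\<^sub>h f w\<^sub>0 w\<^sub>1 u ut utt"
    and t: "t \<in> {0..T}"
  shows "(L2_norm \<Omega> (ut t))\<^sup>2 + \<alpha> * (norm_h \<Omega> \<T> (u t))\<^sup>2 \<le>
    (L2_norm \<Omega> w\<^sub>1 + sqrt \<beta> * norm_h \<Omega> \<T> w\<^sub>0 + 2 * (sqrt T * L2_L2_norm T \<Omega> f))\<^sup>2"
proof -
  have sub: "fun_subspace V" "fun_finite_dim V" "V \<subseteq> H2_piecewise \<T>"
    using V by (auto simp: discrete_space_def)
  have VL: "V \<subseteq> L2 \<Omega>" using sub H2_piecewise_in_L2[OF \<open>open \<Omega>\<close> \<T>(1)] by auto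
  have definite: "\<forall>v\<in>V. L2_norm \<Omega> v = 0 \<longrightarrow> v = (\<lambda>x. 0)"
    using H2_piecewise_L2_norm_definite[OF \<open>open \<Omega>\<close> \<T>(1,3)] sub by blast
  let ?S = "fun_set_sum V (morley \<Omega> \<T>)"
  have "v \<in> ?S" if "v \<in> V" for v
  proof -
    have "(\<lambda>x. v x + 0) \<in> ?S"
      using that zero_in_morley[OF \<T>(2)] unfolding fun_set_sum_def mem_Collect_eq
      by (intro exI[of _ v] exI[of _ "\<lambda>x. 0"] conjI refl)
    then show ?thesis by simp
  qed
  then have VS: "V \<subseteq> ?S" by auto
  have bil: "symmetric_bilinear_on ?S a\<^sub>h"
    using a unfolding discrete_form_def by (rule conjunct1)
  have coer: "\<And>w. w \<in> V \<Longrightarrow> \<alpha> * (norm_h \<Omega> \<T> w)\<^sup>2 \<le> a\<^sub>h w w"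
    and bdd: "\<And>w. w \<in> V \<Longrightarrow> a\<^sub>h w w \<le> \<beta> * norm_h \<Omega> \<T> w * norm_h \<Omega> \<T> w"
    using a unfolding discrete_form_def by blast+
  obtain p where cont: "continuous_on {0..T} (\<lambda>t. L2_norm \<Omega> (ut t))"
    and p: "\<And>t. t \<in> {0..T} \<Longrightarrow> \<bar>p t\<bar> \<le> L2_norm \<Omega> (f t) * L2_norm \<Omega> (ut t)"
    and en: "\<And>t. t \<in> {0..T} \<Longrightarrow> ((\<lambda>s. 2 * p s) has_integral
      ((L2_norm \<Omega> (ut t))\<^sup>2 + a\<^sub>h (u t) (u t)) - ((L2_norm \<Omega> (ut 0))\<^sup>2 + a\<^sub>h (u 0) (u 0))) {0..t}"
    using semidiscrete_energy[OF assms(3) sub(1,2) VL definite bil VS f sol] by blast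
  have uV: "u t \<in> V" if "t \<in> {0..T}" for t using sol that unfolding semidiscrete_solution_def by blast+
  have init: "u 0 = w\<^sub>0" "ut 0 = w\<^sub>1" using sol unfolding semidiscrete_solution_def by blast+
  \<comment> \<open>\<open>r\<close> is chosen so that its square dominates the initial energy, and
    \<open>k\<close> so that it dominates the time integral of the norm of \<open>f\<close>.\<close>
  define r where "r = L2_norm \<Omega> w\<^sub>1 + sqrt \<beta> * norm_h \<Omega> \<T> w\<^sub>0"
  define k where "k = sqrt T * L2_L2_norm T \<Omega> f"
  have r0: "0 \<le> r" using \<open>0 < \<beta>\<close> by (simp add: r_def L2_norm_nonneg norm_h_nonneg)
  have k0: "0 \<le> k" using \<open>0 < T\<close> by (simp add: k_def L2_L2_norm_def)
  have "(L2_norm \<Omega> w\<^sub>1)\<^sup>2 + a\<^sub>h w\<^sub>0 w\<^sub>0 \<le> (L2_norm \<Omega> w\<^sub>1)\<^sup>2 + (sqrt \<beta> * norm_h \<Omega> \<T> w\<^sub>0)\<^sup>2"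
    using bdd[OF uV[of 0]] init \<open>0 < T\<close> \<open>0 < \<beta>\<close>
    by (simp add: power_mult_distrib power2_eq_square[of "norm_h \<Omega> \<T> w\<^sub>0"] mult.assoc)
  also have "\<dots> \<le> r\<^sup>2"
    using \<open>0 < \<beta>\<close> unfolding r_def power2_sum by (simp add: L2_norm_nonneg norm_h_nonneg)
  finally have E0: "(L2_norm \<Omega> w\<^sub>1)\<^sup>2 + a\<^sub>h w\<^sub>0 w\<^sub>0 \<le> r\<^sup>2" .
  have fint: "(\<lambda>t. L2_norm \<Omega> (f t)) integrable_on {0..T}"
    using L2_L2_norm_integrable(1)[OF _ f] \<open>0 < T\<close> by (intro integrable_on_lebesgue_on) auto
  have fle: "integral {0..T} (\<lambda>t. L2_norm \<Omega> (f t)) \<le> k"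
    using L2_L2_norm_integrable[OF _ f] \<open>0 < T\<close> by (simp add: k_def lebesgue_integral_eq_integral)
  have "(L2_norm \<Omega> (ut t))\<^sup>2 + a\<^sub>h (u t) (u t) \<le> (r + 2 * k)\<^sup>2"
  proof (rule quadratic_energy_bound[OF _ cont k0 r0 t])
    show "0 \<le> a\<^sub>h (u t) (u t)" if "t \<in> {0..T}" for t
      using coer[OF uV[OF that]] \<open>0 < \<alpha>\<close> by (smt (verit) mult_nonneg_nonneg zero_le_power2)
    fix t m assume t: "t \<in> {0..T}" and m: "\<And>s. s \<in> {0..T} \<Longrightarrow> L2_norm \<Omega> (ut s) \<le> m"
    have "m \<ge> 0" using m[OF t] L2_norm_nonneg[of \<Omega> "ut t"] by linarith
    have fint': "(\<lambda>t. L2_norm \<Omega> (f t)) integrable_on {0..t}"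
      using integrable_subinterval_real[OF fint, of 0 t] t by auto
    \<comment> \<open>With the velocity bounded by \<open>m\<close>, only the integral of the norm
      of \<open>f\<close> remains; enlarging it to \<open>{0..T}\<close> makes the bound uniform in
      \<open>t\<close>.\<close>
    have "((L2_norm \<Omega> (ut t))\<^sup>2 + a\<^sub>h (u t) (u t)) - ((L2_norm \<Omega> (ut 0))\<^sup>2 + a\<^sub>h (u 0) (u 0))
        \<le> integral {0..t} (\<lambda>s. 2 * m * L2_norm \<Omega> (f s))"
    proof (rule has_integral_le[OF en[OF t] integrable_integral])
      show "(\<lambda>s. 2 * m * L2_norm \<Omega> (f s)) integrable_on {0..t}"
        by (intro integrable_on_mult_right fint')
      fix s assume "s \<in> {0..t}"
      with t have s: "s \<in> {0..T}" by auto
      have "\<bar>p s\<bar> \<le> L2_norm \<Omega> (f s) * m"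
        using p[OF s] mult_left_mono[OF m[OF s] L2_norm_nonneg[of \<Omega> "f s"]] by linarith
      then show "2 * p s \<le> 2 * m * L2_norm \<Omega> (f s)" by (simp add: mult.commute)
    qed
    also have "\<dots> = 2 * m * integral {0..t} (\<lambda>s. L2_norm \<Omega> (f s))" by simp
    also have "\<dots> \<le> 2 * m * integral {0..T} (\<lambda>s. L2_norm \<Omega> (f s))"
      using \<open>m \<ge> 0\<close> t fint fint' by (intro mult_left_mono integral_subset_le) (auto simp: L2_norm_nonneg)
    also have "\<dots> \<le> 2 * m * k" using \<open>m \<ge> 0\<close> fle by (intro mult_left_mono) auto
    finally show "(L2_norm \<Omega> (ut t))\<^sup>2 + a\<^sub>h (u t) (u t) \<le> r\<^sup>2 + 2 * m * k"
      using E0 init by simp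
  qed (use \<open>0 < T\<close> in auto)
  then show ?thesis using coer[OF uV[OF t]] by (simp add: r_def k_def)
qed

theorem lemma2p6:
  fixes \<alpha> \<beta> T :: real
  assumes "0 < \<alpha>" and "0 < \<beta>" and "0 < T"
  shows "\<exists>C>0. \<forall>\<Omega> \<gamma> \<T> V a\<^sub>h J u\<^sub>0 v\<^sub>0 f u\<^sub>h u\<^sub>h\<^sub>t u\<^sub>h\<^sub>t\<^sub>t.
    polygonal_lipschitz_domain \<Omega> \<longrightarrow>
    shape_regular_triangulation \<gamma> \<Omega> \<T> \<longrightarrow>
    discrete_space \<T> V \<longrightarrow>
    discrete_form \<alpha> \<beta> \<Omega> \<T> V a\<^sub>h \<longrightarrow>
    companion_operator \<Omega> \<T> J \<longrightarrow>
    u\<^sub>0 \<in> H2_0 \<Omega> \<longrightarrow> v\<^sub>0 \<in> H2_0 \<Omega> \<longrightarrow> f \<in> L2_L2 T \<Omega> \<longrightarrow>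
    semidiscrete_solution T \<Omega> V a\<^sub>h f (ritz \<Omega> \<T> V a\<^sub>h J u\<^sub>0) (ritz \<Omega> \<T> V a\<^sub>h J v\<^sub>0)
      u\<^sub>h u\<^sub>h\<^sub>t u\<^sub>h\<^sub>t\<^sub>t \<longrightarrow>
    (\<forall>t\<in>{0<..T}.
       L2_norm \<Omega> (u\<^sub>h\<^sub>t t) + norm_h \<Omega> \<T> (u\<^sub>h t) \<le>
       C * (norm_h \<Omega> \<T> (ritz \<Omega> \<T> V a\<^sub>h J u\<^sub>0) + L2_norm \<Omega> (ritz \<Omega> \<T> V a\<^sub>h J v\<^sub>0) +
            L2_L2_norm T \<Omega> f))"
\<comment> \<open>The first factor of the constant comes from bounding the two norms separately by
  \<open>R\<close> and \<open>R / sqrt \<alpha>\<close>. The second adds up the coefficients 1,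
  \<open>sqrt \<beta>\<close> and \<open>2 * sqrt T\<close> of the data in \<open>R\<close>. Only
  \<alpha>, \<beta> and \<open>T\<close> occur, so the constant is the same for all meshes.\<close>
proof (intro exI[of _ "(1 + 1 / sqrt \<alpha>) * (1 + sqrt \<beta> + 2 * sqrt T)"] conjI allI impI ballI)
  show "0 < (1 + 1 / sqrt \<alpha>) * (1 + sqrt \<beta> + 2 * sqrt T)"
    using assms by (intro mult_pos_pos add_pos_pos) auto
  fix \<Omega> \<gamma> \<T> V a\<^sub>h J u\<^sub>0 v\<^sub>0 f u\<^sub>h u\<^sub>h\<^sub>t u\<^sub>h\<^sub>t\<^sub>t t
  assume dom: "polygonal_lipschitz_domain \<Omega>" "shape_regular_triangulation \<gamma> \<Omega> \<T>"
    and V: "discrete_space \<T> V" "discrete_form \<alpha> \<beta> \<Omega> \<T> V a\<^sub>h" and f: "f \<in> L2_L2 T \<Omega>"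
    and sol: "semidiscrete_solution T \<Omega> V a\<^sub>h f (ritz \<Omega> \<T> V a\<^sub>h J u\<^sub>0) (ritz \<Omega> \<T> V a\<^sub>h J v\<^sub>0)
      u\<^sub>h u\<^sub>h\<^sub>t u\<^sub>h\<^sub>t\<^sub>t"
    and t: "t \<in> {0<..T}"
  define y where "y = L2_norm \<Omega> (u\<^sub>h\<^sub>t t)"
  define z where "z = norm_h \<Omega> \<T> (u\<^sub>h t)"
  define r where "r = norm_h \<Omega> \<T> (ritz \<Omega> \<T> V a\<^sub>h J u\<^sub>0)"
  define s where "s = L2_norm \<Omega> (ritz \<Omega> \<T> V a\<^sub>h J v\<^sub>0)"
  define k where "k = L2_L2_norm T \<Omega> f"
  define R where "R = s + sqrt \<beta> * r + 2 * (sqrt T * k)"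
  have nonneg: "0 \<le> y" "0 \<le> z" "0 \<le> r" "0 \<le> s" "0 \<le> k"
    by (auto simp: y_def z_def r_def s_def k_def L2_norm_nonneg norm_h_nonneg L2_L2_norm_def)
  have "open \<Omega>" "finite \<T>" "\<And>K. K \<in> \<T> \<Longrightarrow> 2 simplex K" "\<Union>\<T> \<subseteq> closure \<Omega>"
    using dom by (auto simp: polygonal_lipschitz_domain_def shape_regular_triangulation_def triangulation_def)
  then have "y\<^sup>2 + \<alpha> * z\<^sup>2 \<le> R\<^sup>2"
    using semidiscrete_stability[OF assms _ _ _ _ V f sol, of t] t
    unfolding y_def z_def R_def r_def s_def k_def by auto
  moreover have "0 \<le> \<alpha> * z\<^sup>2" "(sqrt \<alpha> * z)\<^sup>2 = \<alpha> * z\<^sup>2"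
    using assms by (simp_all add: power_mult_distrib)
  ultimately have sq: "y\<^sup>2 \<le> R\<^sup>2" "(sqrt \<alpha> * z)\<^sup>2 \<le> R\<^sup>2"
    using zero_le_power2[of y] by linarith+
  have "0 \<le> R" using nonneg assms by (simp add: R_def)
  then have "y \<le> R" "sqrt \<alpha> * z \<le> R" using sq power2_le_imp_le by blast+
  then have "y \<le> R" "z \<le> R / sqrt \<alpha>" using assms by (simp_all add: field_simps)
  then have "y + z \<le> (1 + 1 / sqrt \<alpha>) * R"
    by (simp add: distrib_right)
  also have "R \<le> (1 + sqrt \<beta> + 2 * sqrt T) * (r + s + k)"
    using nonneg assms by (simp add: R_def algebra_simps add_increasing)
  finally show "L2_norm \<Omega> (u\<^sub>h\<^sub>t t) + norm_h \<Omega> \<T> (u\<^sub>h t) \<le>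
       (1 + 1 / sqrt \<alpha>) * (1 + sqrt \<beta> + 2 * sqrt T) *
       (norm_h \<Omega> \<T> (ritz \<Omega> \<T> V a\<^sub>h J u\<^sub>0) + L2_norm \<Omega> (ritz \<Omega> \<T> V a\<^sub>h J v\<^sub>0) + L2_L2_norm T \<Omega> f)"
    using assms by (simp add: y_def z_def r_def s_def k_def mult.assoc mult_left_mono)
qed

end
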